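(* Let $d_0=\min\{d,M\}$, suppose $R_{\min}=\tilde{\Omega}(\sqrt{d_0})$ and $a\le \frac{R_{\min}}{2}-\sqrt{d_0}\,O\big(\sqrt{\log(\max\{M^2\kappa/\pi_{\min},R_{\max},d_0\})}\big)$, and let $\mathbb{A}=\prod_{i=1}^M\mathbb{B}(\mu_i^*,a)$. Let $X_1,\dots,X_n$ be i.i.d. from $\mathrm{GMM}(\pi,\mu^*,I_d)$. Then there are constants $c,c'>0$ such that with probability at least $1-\exp(-c'd\log n)$, $$\sup_{\mu\in\mathbb{A}}\|G^{(i)}(\mu)-G_n^{(i)}(\mu)\|<\epsilon^{\mathrm{unif}}(n)\qquad\forall i\in[M],\qquad \epsilon^{\mathrm{unif}}(n)=cM^{3/2}(1+3R_{\max})^3\max\{1,\log(\kappa)\}\sqrt{\frac{d\log n}{n}}.$$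
   Context: Fix integers $M\ge 2$, $d\ge1$; weights $\pi_i>0$, $\sum_i\pi_i=1$; centers $\mu_i^*\in\mathbb{R}^d$ with $\sum_i\pi_i\mu_i^*=0$; $\mathrm{GMM}(\pi,\mu^*,I_d)$ has density $\sum_i\pi_i\phi(x\mid\mu_i^*,I_d)$. For stacked $\mu\in\mathbb{R}^{Md}$, $w_i(x;\mu)=\frac{\pi_i\phi(x\mid\mu_i,I_d)}{\sum_j\pi_j\phi(x\mid\mu_j,I_d)}$; $G^{(i)}(\mu)=\mathbb{E}_X[w_i(X;\mu)(X-\mu_i)]$ with $X\sim\mathrm{GMM}(\pi,\mu^*,I_d)$ and $G_n^{(i)}(\mu)=\frac1n\sum_{j=1}^nw_i(X_j;\mu)(X_j-\mu_i)$. $R_{\max}=\max_{i\ne j}\|\mu_i^*-\mu_j^*\|$, $R_{\min}=\min_{i\ne j}\|\mu_i^*-\mu_j^*\|$, $\pi_{\max},\pi_{\min}$ largest/smallest weights, $\kappa=\pi_{\max}/\pi_{\min}$. $O$ hides universal constants; $\tilde\Omega$ ignores logarithmic factors. *)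

theory Defs
  imports "HOL-Probability.Probability"
begin

text \<open>Vectors in R^d are represented as functions nat => real, extensional on {..<d}
  (elements of PiE {..<d} (%_. UNIV)); stacked centers in R^(Md) as functions
  nat => (nat => real), with index i < M.\<close>

definition rvec :: "nat \<Rightarrow> (nat \<Rightarrow> real) set" where
  "rvec d = PiE {..<d} (\<lambda>_. UNIV)"

definition vnorm :: "nat \<Rightarrow> (nat \<Rightarrow> real) \<Rightarrow> real" where
  "vnorm d x = sqrt (\<Sum>k<d. (x k)\<^sup>2)"

definition gauss_dens :: "nat \<Rightarrow> (nat \<Rightarrow> real) \<Rightarrow> (nat \<Rightarrow> real) \<Rightarrow> real" where
  "gauss_dens d m x = (2 * pi) powr (- real d / 2) * exp (- (\<Sum>k<d. (x k - m k)\<^sup>2) / 2)"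

definition gmm :: "nat \<Rightarrow> nat \<Rightarrow> (nat \<Rightarrow> real) \<Rightarrow> (nat \<Rightarrow> nat \<Rightarrow> real) \<Rightarrow> (nat \<Rightarrow> real) measure" where
  "gmm M d w mu = density (PiM {..<d} (\<lambda>_. lborel))
      (\<lambda>x. ennreal (\<Sum>i<M. w i * gauss_dens d (mu i) x))"

definition resp :: "nat \<Rightarrow> nat \<Rightarrow> (nat \<Rightarrow> real) \<Rightarrow> (nat \<Rightarrow> nat \<Rightarrow> real) \<Rightarrow> nat \<Rightarrow> (nat \<Rightarrow> real) \<Rightarrow> real" where
  "resp M d w mu i x = w i * gauss_dens d (mu i) x / (\<Sum>j<M. w j * gauss_dens d (mu j) x)"

definition G_pop :: "nat \<Rightarrow> nat \<Rightarrow> (nat \<Rightarrow> real) \<Rightarrow> (nat \<Rightarrow> nat \<Rightarrow> real) \<Rightarrow> (nat \<Rightarrow> nat \<Rightarrow> real) \<Rightarrow> nat \<Rightarrow> nat \<Rightarrow> real" where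
  "G_pop M d w mustar mu i k =
     (\<integral>x. resp M d w mu i x * (x k - mu i k) \<partial>(gmm M d w mustar))"

definition G_emp :: "nat \<Rightarrow> nat \<Rightarrow> (nat \<Rightarrow> real) \<Rightarrow> nat \<Rightarrow> (nat \<Rightarrow> nat \<Rightarrow> real) \<Rightarrow> (nat \<Rightarrow> nat \<Rightarrow> real) \<Rightarrow> nat \<Rightarrow> nat \<Rightarrow> real" where
  "G_emp M d w n X mu i k =
     (1 / real n) * (\<Sum>j<n. resp M d w mu i (X j) * (X j k - mu i k))"

definition Rmax :: "nat \<Rightarrow> nat \<Rightarrow> (nat \<Rightarrow> nat \<Rightarrow> real) \<Rightarrow> real" where
  "Rmax M d mu = Max {vnorm d (\<lambda>k. mu i k - mu j k) | i j. i < M \<and> j < M \<and> i \<noteq> j}"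

definition Rmin :: "nat \<Rightarrow> nat \<Rightarrow> (nat \<Rightarrow> nat \<Rightarrow> real) \<Rightarrow> real" where
  "Rmin M d mu = Min {vnorm d (\<lambda>k. mu i k - mu j k) | i j. i < M \<and> j < M \<and> i \<noteq> j}"

definition pimax :: "nat \<Rightarrow> (nat \<Rightarrow> real) \<Rightarrow> real" where
  "pimax M w = Max (w ` {..<M})"

definition pimin :: "nat \<Rightarrow> (nat \<Rightarrow> real) \<Rightarrow> real" where
  "pimin M w = Min (w ` {..<M})"

definition kappa :: "nat \<Rightarrow> (nat \<Rightarrow> real) \<Rightarrow> real" where
  "kappa M w = pimax M w / pimin M w"

definition ballprod :: "nat \<Rightarrow> nat \<Rightarrow> (nat \<Rightarrow> nat \<Rightarrow> real) \<Rightarrow> real \<Rightarrow> (nat \<Rightarrow> nat \<Rightarrow> real) set" where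
  "ballprod M d mustar a =
     PiE {..<M} (\<lambda>i. {x \<in> rvec d. vnorm d (\<lambda>k. x k - mustar i k) \<le> a})"

definition eps_unif :: "real \<Rightarrow> nat \<Rightarrow> nat \<Rightarrow> (nat \<Rightarrow> real) \<Rightarrow> (nat \<Rightarrow> nat \<Rightarrow> real) \<Rightarrow> nat \<Rightarrow> real" where
  "eps_unif c M d w mustar n =
     c * real M powr (3/2) * (1 + 3 * Rmax M d mustar) ^ 3 * max 1 (ln (kappa M w))
       * sqrt (real d * ln (real n) / real n)"

end

theory Submission
  imports Defs
begin

text \<open>The statistic \<open>F(x) = w_i(x;\<mu>)(x - \<mu>_i)\<close> is dominated by \<open>x - \<mu>_i\<close> because responsibilities lie in
  \<open>[0,1]\<close>, so its centred version is sub-Gaussian in every direction with variance proxy of order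
  \<open>(1 + 3 R_max)\<^sup>2\<close>, and the norm of an i.i.d. sum has a chi-square type tail
  \<open>2^(d/2) exp (- t\<^sup>2/(4\<sigma>\<^sup>2))\<close>.

  If \<open>d \<le> n\<close>, a union bound over a coordinate grid of mesh \<open>n^(-3)\<close> for the \<open>M d\<close> coordinates of \<open>\<mu>\<close> costs
  only \<open>O(M d R_max log n)\<close> in the exponent; between grid points the logarithms of the responsibilities
  move by at most the mesh times \<open>|x| + O(R_max)\<close>.  If \<open>n < d\<close>, the logarithm of the grid size would
  involve \<open>log d\<close>; here the target accuracy exceeds a constant, and it suffices to bound
  \<open>\<Sum>_j r_j X_j\<close> over all \<open>r \<in> [0,1]^n\<close>.  The norm is convex, so the maximum is attained at one of the
  \<open>2^n\<close> vertices, which is again a union bound.\<close>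

subsection \<open>The Euclidean norm on coordinate functions\<close>

text \<open>Sub-Gaussianity is measured by \<open>E exp (Y^2/K^2) <= 2\<close> because this
  condition passes to every variable that is smaller in absolute value, which a bound on the moment
  generating function does not; that is how domination by \<open>x - mu i\<close> becomes usable. It
  is turned back into an exponential moment bound only after centering, since that form multiplies
  over independent samples.

  The target rate has universal constants and no \<open>log d\<close>, which dictates the split at
  \<open>d <= n\<close>: a mesh that is a power of \<open>n\<close> is then also small against
  \<open>d\<close>. The grid has about \<open>(5 D n^3)^(M d)\<close> points,
  \<open>D = 1 + 3 R_max\<close>; the bound \<open>D <= exp (2 D ln n)\<close> absorbs the radius
  and costs only a factor \<open>sqrt D\<close> in the deviation, well within \<open>D^3\<close>.

  The centering of the mixture gives \<open>|mustar i| <= R_max\<close>, and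
  \<open>a <= R_min/2\<close> then places all admissible centers within \<open>2 R_max\<close> of
  the origin. Rounding to the grid adds at most 1, so the distance to any \<open>mustar i\<close>
  stays below \<open>R_max + (2 R_max + 1) = D\<close>.

  The supremum ranges over an uncountable set, so the probability bound is attached to a measurable
  set \<open>E\<close> inside the good event, the complement of finitely many explicit bad
  events.\<close>

lemma vnorm_eq_L2_set: "vnorm d x = L2_set x {..<d}"
  by (simp add: vnorm_def L2_set_def)

lemma vnorm_nonneg [simp]: "0 \<le> vnorm d x"
  by (simp add: vnorm_eq_L2_set)

lemma vnorm_power2: "(vnorm d x)\<^sup>2 = (\<Sum>k<d. (x k)\<^sup>2)"
  by (simp add: vnorm_def sum_nonneg)

lemma vnorm_cong: "(\<And>k. k < d \<Longrightarrow> x k = y k) \<Longrightarrow> vnorm d x = vnorm d y"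
  by (simp add: vnorm_def)

lemma vnorm_triangle: "vnorm d (\<lambda>k. x k + y k) \<le> vnorm d x + vnorm d y"
  by (simp add: vnorm_eq_L2_set L2_set_triangle_ineq)

lemma vnorm_scale: "vnorm d (\<lambda>k. c * x k) = \<bar>c\<bar> * vnorm d x"
  by (simp add: vnorm_def power_mult_distrib real_sqrt_mult flip: sum_distrib_left)

lemma vnorm_uminus: "vnorm d (\<lambda>k. - x k) = vnorm d x"
  by (simp add: vnorm_def)

lemma vnorm_diff_le: "vnorm d (\<lambda>k. x k - y k) \<le> vnorm d x + vnorm d y"
  using vnorm_triangle[of d x "\<lambda>k. - y k"] by (simp add: vnorm_uminus)

lemma vnorm_diff_commute: "vnorm d (\<lambda>k. x k - y k) = vnorm d (\<lambda>k. y k - x k)"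
  using vnorm_uminus[of d "\<lambda>k. x k - y k"] by simp

lemma vnorm_diff_triangle:
  "vnorm d (\<lambda>k. x k - z k) \<le> vnorm d (\<lambda>k. x k - y k) + vnorm d (\<lambda>k. y k - z k)"
  using vnorm_triangle[of d "\<lambda>k. x k - y k" "\<lambda>k. y k - z k"] by simp

lemma vnorm_0: "vnorm d (\<lambda>k. 0) = 0"
  by (simp add: vnorm_def)

lemma vnorm_sum_le: "finite A \<Longrightarrow> vnorm d (\<lambda>k. \<Sum>i\<in>A. f i k) \<le> (\<Sum>i\<in>A. vnorm d (f i))"
proof (induction A rule: finite_induct)
  case (insert a A)
  then show ?case
    using vnorm_triangle[of d "f a" "\<lambda>k. \<Sum>i\<in>A. f i k"] by simp
qed (simp add: vnorm_0)

lemma vnorm_cauchy_schwarz: "\<bar>\<Sum>k<d. u k * x k\<bar> \<le> vnorm d u * vnorm d x"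
proof -
  have "\<bar>\<Sum>k<d. u k * x k\<bar> \<le> (\<Sum>k<d. \<bar>u k\<bar> * \<bar>x k\<bar>)"
    using sum_abs[of "\<lambda>k. u k * x k" "{..<d}"] by (simp add: abs_mult)
  then show ?thesis
    unfolding vnorm_eq_L2_set using L2_set_mult_ineq order_trans by blast
qed

text \<open>Tested at \<open>u = x / |x|\<close>, the linear form equals the norm. This reduces
  bounds on vector-valued means and weighted sums to scalar ones.\<close>

lemma vnorm_le_by_duality:
  assumes "0 \<le> b" "\<And>u. vnorm d u \<le> 1 \<Longrightarrow> (\<Sum>k<d. u k * x k) \<le> b"
  shows "vnorm d x \<le> b"
proof (cases "vnorm d x = 0")
  case False
  define u where "u = (\<lambda>k. (1 / vnorm d x) * x k)"
  have "vnorm d u = 1"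
    unfolding u_def vnorm_scale using False by simp
  moreover have "(\<Sum>k<d. u k * x k) = vnorm d x"
  proof -
    have "(\<Sum>k<d. u k * x k) = (1 / vnorm d x) * (\<Sum>k<d. (x k)\<^sup>2)"
      by (simp add: u_def sum_distrib_left power2_eq_square mult.assoc)
    also have "\<dots> = vnorm d x"
      unfolding vnorm_power2[symmetric] using False by (simp add: power2_eq_square)
    finally show ?thesis .
  qed
  ultimately show ?thesis
    using assms(2)[of u] by simp
qed (use assms in simp)

subsection \<open>Sub-Gaussian random vectors\<close>

lemma nn_integral_normal_density:
  "0 < s \<Longrightarrow> (\<integral>\<^sup>+x. ennreal (normal_density m s x) \<partial>lborel) = 1"
  by (subst nn_integral_eq_integral) auto

lemma normal_mgf:
  "(\<integral>\<^sup>+x. ennreal (normal_density m 1 x) * ennreal (exp (t * x)) \<partial>lborel)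
    = ennreal (exp (t * m + t\<^sup>2 / 2))"
proof -
  have "normal_density m 1 x * exp (t * x) = exp (t * m + t\<^sup>2 / 2) * normal_density (m + t) 1 x" for x
    by (simp add: normal_density_def flip: exp_add)
       (simp add: power2_eq_square field_simps)
  then have "(\<integral>\<^sup>+x. ennreal (normal_density m 1 x) * ennreal (exp (t * x)) \<partial>lborel)
    = (\<integral>\<^sup>+x. ennreal (exp (t * m + t\<^sup>2 / 2)) * ennreal (normal_density (m + t) 1 x) \<partial>lborel)"
    by (simp flip: ennreal_mult)
  then show ?thesis
    by (simp add: nn_integral_cmult nn_integral_normal_density)
qed

text \<open>The factor \<open>exp (x^2/4)\<close> doubles the variance: the integrand is
  \<open>sqrt 2\<close> times the density of variance 2. This is the source of every
  \<open>sqrt 2 ^ d\<close> below.\<close>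

lemma std_normal_exp_square:
  "(\<integral>\<^sup>+x. ennreal (normal_density 0 1 x) * ennreal (exp (x\<^sup>2 / 4)) \<partial>lborel) = ennreal (sqrt 2)"
proof -
  have "normal_density 0 1 x * exp (x\<^sup>2 / 4) = sqrt 2 * normal_density 0 (sqrt 2) x" for x
    by (simp add: normal_density_def real_sqrt_mult field_simps flip: exp_add)
  then have "(\<integral>\<^sup>+x. ennreal (normal_density 0 1 x) * ennreal (exp (x\<^sup>2 / 4)) \<partial>lborel)
    = (\<integral>\<^sup>+x. ennreal (sqrt 2) * ennreal (normal_density 0 (sqrt 2) x) \<partial>lborel)"
    by (simp flip: ennreal_mult)
  then show ?thesis
    by (simp add: nn_integral_cmult nn_integral_normal_density)
qed

text \<open>Writing \<open>exp (|V|\<^sup>2/(4\<sigma>\<^sup>2))\<close> as the average of \<open>exp (\<langle>g, V\<rangle>/(\<sigma>\<surd>2))\<close> over a standard Gaussian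
  \<open>g\<close> and exchanging the integrals avoids a net on the sphere.\<close>

lemma nn_integral_exp_norm_square_le:
  fixes V :: "nat \<Rightarrow> 'a \<Rightarrow> real"
  assumes "sigma_finite_measure P"
    and V [measurable]: "\<And>k. k < d \<Longrightarrow> V k \<in> borel_measurable P"
    and "\<sigma> > 0" "A \<ge> 0"
    and mgf: "\<And>u. (\<integral>\<^sup>+x. ennreal (exp (\<Sum>k<d. u k * V k x)) \<partial>P)
                \<le> ennreal (A * exp (\<sigma>\<^sup>2 * (\<Sum>k<d. (u k)\<^sup>2) / 2))"
  shows "(\<integral>\<^sup>+x. ennreal (exp ((\<Sum>k<d. (V k x)\<^sup>2) / (4 * \<sigma>\<^sup>2))) \<partial>P) \<le> ennreal (A * sqrt 2 ^ d)"
proof -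
  define N where "N = (density lborel (\<lambda>x. ennreal (normal_density 0 1 x)))"
  \<comment> \<open>With this \<open>b\<close>, averaging \<open>exp (b * <g, V>)\<close> over
    \<open>g\<close> gives \<open>exp (b^2 |V|^2 / 2) = exp (|V|^2/(4 \<sigma>^2))\<close>, while
    the hypothesis at \<open>u = b g\<close> has exponent
    \<open>\<sigma>^2 b^2 |g|^2 / 2 = |g|^2/4\<close>.\<close>
  define b where "b = 1 / (\<sigma> * sqrt 2)"
  have b2: "b\<^sup>2 = 1 / (2 * \<sigma>\<^sup>2)"
    by (simp add: b_def power_mult_distrib power_divide)
  have sN [measurable_cong]: "sets N = sets borel"
    by (simp add: N_def)
  have mN: "f \<in> borel_measurable N" if "f \<in> borel_measurable borel" for f :: "real \<Rightarrow> ennreal"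
    using that sN by (simp cong: measurable_cong_sets)
  interpret N: prob_space N
    unfolding N_def by (rule prob_space_normal_density) simp
  interpret PN: product_prob_space "\<lambda>_::nat. N" "{..<d}"
    by (rule product_prob_spaceI) (rule N.prob_space_axioms)
  interpret P: sigma_finite_measure P by fact
  let ?G = "PiM {..<d} (\<lambda>_. N)"
  interpret G: prob_space ?G
    by (rule prob_space_PiM) (rule N.prob_space_axioms)
  interpret pair_sigma_finite P ?G ..
  have [measurable]: "(\<lambda>g. g k) \<in> borel_measurable ?G" if "k < d" for k
    using measurable_component_singleton[of k "{..<d}" "\<lambda>_. N"] that by (simp add: sN cong: measurable_cong_sets)
  have mg: "(\<integral>\<^sup>+g. ennreal (exp (\<Sum>k<d. b * g k * V k x)) \<partial>?G)
     = ennreal (exp ((\<Sum>k<d. (V k x)\<^sup>2) / (4 * \<sigma>\<^sup>2)))" for x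
  proof -
    have "(\<integral>\<^sup>+g. ennreal (exp (\<Sum>k<d. b * g k * V k x)) \<partial>?G)
      = (\<integral>\<^sup>+g. (\<Prod>k<d. ennreal (exp ((b * V k x) * g k))) \<partial>?G)"
      by (simp add: exp_sum prod_ennreal ac_simps)
    also have "\<dots> = (\<Prod>k<d. \<integral>\<^sup>+y. ennreal (exp ((b * V k x) * y)) \<partial>N)"
      by (rule PN.product_nn_integral_prod, simp, rule mN) simp
    also have "\<dots> = (\<Prod>k<d. ennreal (exp ((b * V k x)\<^sup>2 / 2)))"
      unfolding N_def by (simp add: nn_integral_density normal_mgf)
    also have "\<dots> = ennreal (exp (\<Sum>k<d. (b * V k x)\<^sup>2 / 2))"
      by (simp add: exp_sum prod_ennreal)
    also have "(\<Sum>k<d. (b * V k x)\<^sup>2 / 2) = (\<Sum>k<d. (V k x)\<^sup>2) / (4 * \<sigma>\<^sup>2)"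
      by (simp add: power_mult_distrib b2 sum_divide_distrib)
    finally show ?thesis .
  qed
  have "(\<integral>\<^sup>+x. ennreal (exp ((\<Sum>k<d. (V k x)\<^sup>2) / (4 * \<sigma>\<^sup>2))) \<partial>P)
     = (\<integral>\<^sup>+x. (\<integral>\<^sup>+g. ennreal (exp (\<Sum>k<d. b * g k * V k x)) \<partial>?G) \<partial>P)"
    by (simp add: mg)
  also have "\<dots> = (\<integral>\<^sup>+g. (\<integral>\<^sup>+x. ennreal (exp (\<Sum>k<d. b * g k * V k x)) \<partial>P) \<partial>?G)"
    by (rule Fubini'[symmetric]) measurable
  also have "\<dots> \<le> (\<integral>\<^sup>+g. ennreal (A * exp (\<sigma>\<^sup>2 * (\<Sum>k<d. (b * g k)\<^sup>2) / 2)) \<partial>?G)"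
    by (intro nn_integral_mono mgf)
  also have "\<dots> = (\<integral>\<^sup>+g. ennreal A * (\<Prod>k<d. ennreal (exp ((g k)\<^sup>2 / 4))) \<partial>?G)"
  proof (rule nn_integral_cong)
    fix g
    have "\<sigma>\<^sup>2 * (\<Sum>k<d. (b * g k)\<^sup>2) / 2 = (\<Sum>k<d. (g k)\<^sup>2 / 4)"
      using \<open>\<sigma> > 0\<close> by (simp add: power_mult_distrib b2 sum_divide_distrib sum_distrib_left)
    then show "ennreal (A * exp (\<sigma>\<^sup>2 * (\<Sum>k<d. (b * g k)\<^sup>2) / 2))
      = ennreal A * (\<Prod>k<d. ennreal (exp ((g k)\<^sup>2 / 4)))"
      using \<open>A \<ge> 0\<close> by (simp add: exp_sum prod_ennreal ennreal_mult prod_nonneg)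
  qed
  also have "\<dots> = ennreal A * (\<integral>\<^sup>+g. (\<Prod>k<d. ennreal (exp ((g k)\<^sup>2 / 4))) \<partial>?G)"
    by (rule nn_integral_cmult) measurable
  also have "(\<integral>\<^sup>+g. (\<Prod>k<d. ennreal (exp ((g k)\<^sup>2 / 4))) \<partial>?G) = (\<Prod>k<d. \<integral>\<^sup>+y. ennreal (exp (y\<^sup>2 / 4)) \<partial>N)"
    by (rule PN.product_nn_integral_prod, simp, rule mN) simp
  also have "\<dots> = ennreal (sqrt 2 ^ d)"
    unfolding N_def by (simp add: nn_integral_density std_normal_exp_square ennreal_power)
  finally show ?thesis
    using \<open>A \<ge> 0\<close> by (simp add: ennreal_mult)
qed

text \<open>Markov's inequality for \<open>exp (|V|^2/(4 \<sigma>^2))\<close>. The exponent is half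
  the critical value \<open>1/(2 \<sigma>^2)\<close>, so each coordinate costs only a factor
  \<open>sqrt 2\<close>.\<close>

lemma (in prob_space) prob_norm_ge_le:
  fixes V :: "nat \<Rightarrow> 'a \<Rightarrow> real"
  assumes V [measurable]: "\<And>k. k < d \<Longrightarrow> V k \<in> borel_measurable M"
    and "\<sigma> > 0" "t \<ge> 0"
    and mgf: "\<And>u. (\<integral>\<^sup>+x. ennreal (exp (\<Sum>k<d. u k * V k x)) \<partial>M)
                \<le> ennreal (exp (\<sigma>\<^sup>2 * (\<Sum>k<d. (u k)\<^sup>2) / 2))"
  shows "prob {x \<in> space M. t \<le> vnorm d (\<lambda>k. V k x)} \<le> sqrt 2 ^ d * exp (- t\<^sup>2 / (4 * \<sigma>\<^sup>2))"
proof -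
  let ?f = "\<lambda>x. ennreal (exp ((\<Sum>k<d. (V k x)\<^sup>2) / (4 * \<sigma>\<^sup>2)))"
  let ?c = "ennreal (exp (- t\<^sup>2 / (4 * \<sigma>\<^sup>2)))"
  have "emeasure M {x \<in> space M. t \<le> vnorm d (\<lambda>k. V k x)} \<le> emeasure M {x \<in> space M. 1 \<le> ?c * ?f x}"
  proof (rule emeasure_mono)
    have "1 \<le> ?c * ?f x" if "t \<le> vnorm d (\<lambda>k. V k x)" for x
    proof -
      have "t\<^sup>2 \<le> (\<Sum>k<d. (V k x)\<^sup>2)"
        using power_mono[OF that \<open>t \<ge> 0\<close>, of 2] by (simp add: vnorm_power2)
      then have "t\<^sup>2 / (4 * \<sigma>\<^sup>2) \<le> (\<Sum>k<d. (V k x)\<^sup>2) / (4 * \<sigma>\<^sup>2)"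
        by (intro divide_right_mono) auto
      then have "1 \<le> exp (- t\<^sup>2 / (4 * \<sigma>\<^sup>2)) * exp ((\<Sum>k<d. (V k x)\<^sup>2) / (4 * \<sigma>\<^sup>2))"
        by (simp flip: exp_add)
      then show ?thesis
        by (metis ennreal_1 ennreal_leI ennreal_mult exp_ge_zero)
    qed
    then show "{x \<in> space M. t \<le> vnorm d (\<lambda>k. V k x)} \<subseteq> {x \<in> space M. 1 \<le> ?c * ?f x}"
      by auto
  qed measurable
  also have "\<dots> \<le> ?c * (\<integral>\<^sup>+x. ?f x * indicator (space M) x \<partial>M)"
    by (rule nn_integral_Markov_inequality) measurable
  also have "(\<integral>\<^sup>+x. ?f x * indicator (space M) x \<partial>M) = (\<integral>\<^sup>+x. ?f x \<partial>M)"
    by (rule nn_integral_cong) simp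
  also have "?c * \<dots> \<le> ?c * ennreal (1 * sqrt 2 ^ d)"
    by (intro mult_left_mono nn_integral_exp_norm_square_le)
       (use \<open>\<sigma> > 0\<close> mgf sigma_finite_measure_axioms in auto)
  also have "\<dots> = ennreal (sqrt 2 ^ d * exp (- t\<^sup>2 / (4 * \<sigma>\<^sup>2)))"
    by (simp add: mult.commute flip: ennreal_mult)
  finally show ?thesis
    unfolding emeasure_eq_measure by (subst (asm) ennreal_le_iff) auto
qed

section \<open>Scalar variables: from a bound on \<open>E exp (Y^2/K^2)\<close> to a centered
  exponential moment\<close>

text \<open>Isolates the linear term, which vanishes in expectation for a centered variable; what
  remains is quadratic in the exponent.\<close>

lemma exp_le_self_plus_exp_square: "exp x \<le> x + exp (x\<^sup>2)" for x :: real
proof -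
  have sq: "1 + x\<^sup>2 \<le> exp (x\<^sup>2)"
    by simp
  consider "x \<le> 0" | "0 \<le> x" "x \<le> 1" | "x > 1"
    by linarith
  then show ?thesis
  proof cases
    case 1
    define y where "y = - x"
    have "y \<ge> 0" "exp y \<ge> 1 + y"
      using 1 exp_ge_add_one_self[of y] by (auto simp: y_def)
    \<comment> \<open>The product is \<open>1 + y^3\<close>; together with
      \<open>1 + y <= exp y\<close> it gives \<open>exp (- y) <= 1 - y + y^2\<close>.\<close>
    have "1 \<le> (1 + y) * (1 - y + y\<^sup>2)"
      using \<open>y \<ge> 0\<close> by (simp add: algebra_simps power2_eq_square)
    also have "\<dots> \<le> exp y * (1 - y + y\<^sup>2)"
    proof (rule mult_right_mono)
      have "0 \<le> (1 - y / 2)\<^sup>2 + 3 / 4 * y\<^sup>2" by simp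
      then show "0 \<le> 1 - y + y\<^sup>2" by (simp add: power2_eq_square algebra_simps)
    qed fact
    finally have "exp (- y) \<le> 1 - y + y\<^sup>2"
      by (simp add: exp_minus field_simps)
    then show ?thesis
      using sq unfolding y_def minus_minus power2_minus by linarith
  next
    case 2
    then have "exp x \<le> 1 + x + x\<^sup>2"
      by (intro exp_bound)
    then show ?thesis using sq by linarith
  next
    case 3
    then have "x \<le> x\<^sup>2"
      by (simp add: power2_eq_square)
    then have "exp x \<le> exp (x\<^sup>2)" by simp
    then show ?thesis using 3 by linarith
  qed
qed

text \<open>The chord of the convex exponential between 0 and \<open>q\<close>. It controls the
  expectation at a fraction \<open>p\<close> of an exponent when only the one at the full exponent
  is known.\<close>

lemma exp_mult_le_affine: "exp (p * q) \<le> 1 + p * (exp q - 1)" if "0 \<le> p" "p \<le> 1" for p q :: real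
proof -
  have "exp (1 * ((1 - p) *\<^sub>R 0 + p *\<^sub>R q)) \<le> (1 - p) * exp (1 * 0) + p * exp (1 * q)"
    using that by (intro convex_onD[OF convex_on_exp]) auto
  then show ?thesis
    by (simp add: algebra_simps)
qed

context prob_space
begin

text \<open>Everything follows from \<open>1 + y <= exp y\<close> at \<open>y = Y^2/K^2\<close>,
  which gives \<open>Y^2 <= K^2 (exp (Y^2/K^2) - 1)\<close> pointwise; the bound on the mean then
  comes from nonnegativity of the variance.\<close>

lemma psi2_moments:
  fixes Y :: "'a \<Rightarrow> real"
  assumes [measurable]: "Y \<in> borel_measurable M" and "K > 0"
    and psi: "(\<integral>\<^sup>+x. ennreal (exp ((Y x)\<^sup>2 / K\<^sup>2)) \<partial>M) \<le> 2"
  shows psi2_integrable_exp: "integrable M (\<lambda>x. exp ((Y x)\<^sup>2 / K\<^sup>2))"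
    and psi2_expectation_exp: "expectation (\<lambda>x. exp ((Y x)\<^sup>2 / K\<^sup>2)) \<le> 2"
    and psi2_integrable_square: "integrable M (\<lambda>x. (Y x)\<^sup>2)"
    and psi2_integrable: "integrable M Y"
    and psi2_second_moment: "expectation (\<lambda>x. (Y x)\<^sup>2) \<le> K\<^sup>2"
    and psi2_abs_expectation: "\<bar>expectation Y\<bar> \<le> K"
proof -
  let ?e = "\<lambda>x. exp ((Y x)\<^sup>2 / K\<^sup>2)"
  show ie: "integrable M ?e"
    using psi by (intro integrableI_bounded) (auto intro: le_less_trans)
  have "ennreal (expectation ?e) \<le> ennreal 2"
    using psi by (subst nn_integral_eq_integral[symmetric, OF ie]) auto
  then show ee: "expectation ?e \<le> 2"
    by (subst (asm) ennreal_le_iff) auto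
  have le: "(Y x)\<^sup>2 \<le> K\<^sup>2 * (?e x - 1)" for x
  proof -
    have "K\<^sup>2 * ((Y x)\<^sup>2 / K\<^sup>2) \<le> K\<^sup>2 * (?e x - 1)"
    proof (rule mult_left_mono)
      show "(Y x)\<^sup>2 / K\<^sup>2 \<le> ?e x - 1"
        using exp_ge_add_one_self[of "(Y x)\<^sup>2 / K\<^sup>2"] by linarith
    qed simp
    then show ?thesis using \<open>K > 0\<close> by simp
  qed
  have ir: "integrable M (\<lambda>x. K\<^sup>2 * (?e x - 1))"
    using ie by auto
  show i2: "integrable M (\<lambda>x. (Y x)\<^sup>2)"
    by (rule Bochner_Integration.integrable_bound[OF ir]) (use le in auto)
  show iY: "integrable M Y"
    by (rule square_integrable_imp_integrable) (use i2 in auto)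
  have "expectation (\<lambda>x. (Y x)\<^sup>2) \<le> expectation (\<lambda>x. K\<^sup>2 * (?e x - 1))"
    by (intro integral_mono i2 ir le)
  also have "\<dots> = K\<^sup>2 * (expectation ?e - 1)"
    using ie by (simp add: prob_space)
  also have "\<dots> \<le> K\<^sup>2 * 1"
    using ee by (intro mult_left_mono) auto
  finally show m2: "expectation (\<lambda>x. (Y x)\<^sup>2) \<le> K\<^sup>2" by simp
  have "0 \<le> variance Y" by simp
  also have "variance Y = expectation (\<lambda>x. (Y x)\<^sup>2) - (expectation Y)\<^sup>2"
    using iY i2 by (rule variance_eq)
  finally have "(expectation Y)\<^sup>2 \<le> K\<^sup>2" using m2 by simp
  then show "\<bar>expectation Y\<bar> \<le> K"
    using \<open>K > 0\<close> by (simp add: abs_le_square_iff[symmetric])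
qed

text \<open>Two regimes of \<open>l\<close>: for small \<open>l\<close> the centering must be
  exploited to get rid of the first-order term, for large \<open>l\<close> a crude Young inequality
  suffices because constants are absorbed by \<open>K^2 l^2 > 1/2\<close>.\<close>

lemma centered_mgf_of_psi2:
  fixes Y :: "'a \<Rightarrow> real"
  assumes [measurable]: "Y \<in> borel_measurable M" and "K > 0"
    and psi: "(\<integral>\<^sup>+x. ennreal (exp ((Y x)\<^sup>2 / K\<^sup>2)) \<partial>M) \<le> 2"
  shows "(\<integral>\<^sup>+x. ennreal (exp (l * (Y x - expectation Y))) \<partial>M) \<le> ennreal (exp (4 * K\<^sup>2 * l\<^sup>2))"
proof -
  note mom = psi2_moments[OF assms]
  define m where "m = expectation Y"
  let ?e = "\<lambda>x. exp ((Y x)\<^sup>2 / K\<^sup>2)"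
  have m: "\<bar>m\<bar> \<le> K" "m\<^sup>2 \<le> K\<^sup>2"
    using mom(6) \<open>K > 0\<close> by (auto simp: m_def abs_le_square_iff[symmetric])
  have bound: "(\<integral>\<^sup>+x. ennreal (f x) \<partial>M) \<le> ennreal B"
    if "integrable M g" "f \<in> borel_measurable M" "\<And>x. 0 \<le> f x" "\<And>x. f x \<le> g x" "expectation g \<le> B" for f g B
  proof -
    have "(\<integral>\<^sup>+x. ennreal (f x) \<partial>M) \<le> (\<integral>\<^sup>+x. ennreal (g x) \<partial>M)"
      using that by (intro nn_integral_mono ennreal_leI) auto
    also have "\<dots> = ennreal (expectation g)"
      by (rule nn_integral_eq_integral) (use that order_trans in blast)+
    also have "\<dots> \<le> ennreal B" using that by (intro ennreal_leI)
    finally show ?thesis .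
  qed
  show ?thesis
  proof (cases "2 * K\<^sup>2 * l\<^sup>2 \<le> 1")
    case True
    \<comment> \<open>The square of \<open>l (Y - m)\<close> is at most
      \<open>p + p Y^2/K^2\<close>. Each of the two summands contributes a factor
      \<open>exp p\<close> after integration, and \<open>exp (2 p)\<close> is the claimed
      bound.\<close>
    define p where "p = 2 * K\<^sup>2 * l\<^sup>2"
    have p: "0 \<le> p" "p \<le> 1" using True by (auto simp: p_def)
    let ?g = "\<lambda>x. l * (Y x - m) + exp p * (1 + p * (?e x - 1))"
    show ?thesis
      unfolding m_def[symmetric]
    proof (rule bound)
      show "integrable M ?g" using mom(1,4) by auto
      show "exp (l * (Y x - m)) \<le> ?g x" for x
      proof -
        have "(l * (Y x - m))\<^sup>2 \<le> l\<^sup>2 * (2 * (Y x)\<^sup>2 + 2 * m\<^sup>2)"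
        proof -
          have "0 \<le> (Y x + m)\<^sup>2" by simp
          then have "(Y x - m)\<^sup>2 \<le> 2 * (Y x)\<^sup>2 + 2 * m\<^sup>2"
            by (simp add: power2_eq_square algebra_simps)
          then show ?thesis by (simp add: power_mult_distrib mult_left_mono)
        qed
        also have "\<dots> \<le> l\<^sup>2 * (2 * (Y x)\<^sup>2 + 2 * K\<^sup>2)"
          using m by (intro mult_left_mono) auto
        also have "\<dots> = p + p * ((Y x)\<^sup>2 / K\<^sup>2)"
          using \<open>K > 0\<close> by (simp add: p_def algebra_simps)
        finally have "exp ((l * (Y x - m))\<^sup>2) \<le> exp (p + p * ((Y x)\<^sup>2 / K\<^sup>2))"
          by simp
        also have "\<dots> = exp p * exp (p * ((Y x)\<^sup>2 / K\<^sup>2))"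
          by (rule exp_add)
        also have "\<dots> \<le> exp p * (1 + p * (?e x - 1))"
          by (intro mult_left_mono exp_mult_le_affine p) auto
        finally show ?thesis
          using exp_le_self_plus_exp_square[of "l * (Y x - m)"] by linarith
      qed
      have "expectation ?g = exp p * (1 + p * (expectation ?e - 1))"
        using mom(1,4) by (simp add: prob_space m_def)
      also have "\<dots> \<le> exp p * (1 + p * 1)"
        using mom(2) p by (intro mult_left_mono add_left_mono) auto
      also have "\<dots> \<le> exp p * exp p"
        using exp_ge_add_one_self[of p] by (intro mult_left_mono) auto
      also have "\<dots> = exp (4 * K\<^sup>2 * l\<^sup>2)"
        by (simp add: p_def flip: exp_add)
      finally show "expectation ?g \<le> exp (4 * K\<^sup>2 * l\<^sup>2)" .
    qed auto
  next
    case False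
    \<comment> \<open>Young's inequality splits \<open>l Y\<close> into
      \<open>l^2 K^2/4 + Y^2/K^2\<close>, and the mean costs \<open>l^2 K^2 + 1/4\<close>. With
      \<open>2 <= exp (3/4)\<close> the exponent totals \<open>5/4 K^2 l^2 + 1\<close>, below
      \<open>4 K^2 l^2\<close> in this case.\<close>
    let ?c = "exp (5 / 4 * K\<^sup>2 * l\<^sup>2 + 1 / 4)"
    have e: "2 \<le> exp (3 / 4 :: real)"
      using exp_lower_Taylor_quadratic[of "3 / 4 :: real"] by (simp add: power2_eq_square)
    show ?thesis
      unfolding m_def[symmetric]
    proof (rule bound)
      show "integrable M (\<lambda>x. ?c * ?e x)" using mom(1) by auto
      show "exp (l * (Y x - m)) \<le> ?c * ?e x" for x
      proof -
        have "0 \<le> (l * K / 2 - Y x / K)\<^sup>2" by simp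
        then have 1: "l * Y x \<le> l\<^sup>2 * K\<^sup>2 / 4 + (Y x)\<^sup>2 / K\<^sup>2"
          using \<open>K > 0\<close> by (simp add: power2_eq_square algebra_simps)
        have "- (l * m) \<le> \<bar>l\<bar> * \<bar>m\<bar>" by (metis abs_ge_minus_self abs_mult)
        also have "\<dots> \<le> \<bar>l\<bar> * K" using m by (intro mult_left_mono) auto
        also have "\<dots> \<le> l\<^sup>2 * K\<^sup>2 + 1 / 4"
        proof -
          have "0 \<le> (\<bar>l\<bar> * K - 1 / 2)\<^sup>2" by simp
          then show ?thesis by (simp add: power2_eq_square algebra_simps)
        qed
        finally have "l * (Y x - m) \<le> (5 / 4 * K\<^sup>2 * l\<^sup>2 + 1 / 4) + (Y x)\<^sup>2 / K\<^sup>2"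
          using 1 by (simp add: algebra_simps)
        then show ?thesis by (simp flip: exp_add)
      qed
      have "expectation (\<lambda>x. ?c * ?e x) = ?c * expectation ?e" using mom(1) by simp
      also have "\<dots> \<le> ?c * 2" using mom(2) by (intro mult_left_mono) auto
      also have "\<dots> \<le> ?c * exp (3 / 4)" using e by (intro mult_left_mono) auto
      also have "\<dots> = exp (5 / 4 * K\<^sup>2 * l\<^sup>2 + 1)" by (simp flip: exp_add)
      also have "\<dots> \<le> exp (4 * K\<^sup>2 * l\<^sup>2)" using False by simp
      finally show "expectation (\<lambda>x. ?c * ?e x) \<le> exp (4 * K\<^sup>2 * l\<^sup>2)" .
    qed auto
  qed
qed

end

subsection \<open>Concentration for Gaussian mixtures\<close>

lemma gauss_dens_eq_prod: "gauss_dens d m x = (\<Prod>k<d. normal_density (m k) 1 (x k))"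
proof -
  have "1 / sqrt (2 * pi) = (2 * pi) powr (- (1 / 2))"
    by (simp add: powr_minus_divide powr_half_sqrt)
  then have p: "(1 / sqrt (2 * pi)) ^ d = (2 * pi) powr (- real d / 2)"
    by (simp add: powr_power)
  have e: "exp (- (\<Sum>k<d. (x k - m k)\<^sup>2) / 2) = (\<Prod>k<d. exp (- (x k - m k)\<^sup>2 / 2))"
    by (subst exp_sum[symmetric]) (auto simp: sum_negf sum_divide_distrib)
  show ?thesis
    unfolding gauss_dens_def p[symmetric] e
    by (simp add: normal_density_def power_one_over prod_dividef)
qed

lemma gauss_dens_pos: "0 < gauss_dens d m x"
  by (simp add: gauss_dens_def)

lemma resp_nonneg_le_1:
  assumes "\<forall>j<M. 0 < w j" "i < M"
  shows "0 \<le> resp M d w mu i x" "resp M d w mu i x \<le> 1"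
proof -
  let ?t = "\<lambda>j. w j * gauss_dens d (mu j) x"
  have pos: "0 < ?t j" if "j < M" for j
    using assms that gauss_dens_pos by simp
  have "?t i \<le> (\<Sum>j<M. ?t j)"
    using assms pos by (intro member_le_sum) (auto intro: less_imp_le)
  then show "0 \<le> resp M d w mu i x" "resp M d w mu i x \<le> 1"
    using pos[OF \<open>i < M\<close>] by (auto simp: resp_def divide_le_eq)
qed

locale gmm_model =
  fixes M d :: nat and w :: "nat \<Rightarrow> real" and mustar :: "nat \<Rightarrow> nat \<Rightarrow> real"
  assumes w_pos: "\<forall>i<M. 0 < w i" and w_sum: "(\<Sum>i<M. w i) = 1"
begin

abbreviation P where "P \<equiv> gmm M d w mustar"

lemma sets_P [measurable_cong]: "sets P = sets (PiM {..<d} (\<lambda>_. borel))"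
  by (simp add: gmm_def cong: sets_PiM_cong)

lemma component_measurable [measurable]: "k < d \<Longrightarrow> (\<lambda>x. x k) \<in> borel_measurable P"
  using measurable_component_singleton[of k "{..<d}" "\<lambda>_. borel"] sets_P
  by (simp cong: measurable_cong_sets)

lemma gauss_dens_measurable [measurable]: "gauss_dens d m \<in> borel_measurable P"
  unfolding gauss_dens_def[abs_def] by measurable

lemma resp_measurable [measurable]: "resp M d w mu i \<in> borel_measurable P"
  unfolding resp_def[abs_def] by measurable

lemma gmm_mgf:
  "(\<integral>\<^sup>+x. ennreal (exp (\<Sum>k<d. u k * x k)) \<partial>P)
    = ennreal (\<Sum>i<M. w i * exp (\<Sum>k<d. u k * mustar i k + (u k)\<^sup>2 / 2))"
proof -
  interpret L: product_sigma_finite "\<lambda>_::nat. lborel :: real measure" ..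
  let ?L = "PiM {..<d} (\<lambda>_. lborel :: real measure)"
  let ?f = "\<lambda>x. ennreal (exp (\<Sum>k<d. u k * x k))"
  let ?g = "\<lambda>i k y. ennreal (normal_density (mustar i k) 1 y) * ennreal (exp (u k * y))"
  have [measurable]: "(\<lambda>x. x k) \<in> borel_measurable ?L" if "k < d" for k
    using measurable_component_singleton[of k "{..<d}" "\<lambda>_. lborel :: real measure"] that by simp
  have gm: "gauss_dens d m \<in> borel_measurable ?L" for m
    unfolding gauss_dens_def[abs_def] by measurable
  have fm: "?f \<in> borel_measurable ?L"
    by measurable
  have "(\<integral>\<^sup>+x. ?f x \<partial>P) = (\<integral>\<^sup>+x. ennreal (\<Sum>i<M. w i * gauss_dens d (mustar i) x) * ?f x \<partial>?L)"
    unfolding gmm_def using gm fm by (intro nn_integral_density) auto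
  also have "\<dots> = (\<integral>\<^sup>+x. (\<Sum>i<M. ennreal (w i) * (\<Prod>k<d. ?g i k (x k))) \<partial>?L)"
  proof (rule nn_integral_cong)
    fix x
    have "ennreal (\<Sum>i<M. w i * gauss_dens d (mustar i) x) * ?f x
       = (\<Sum>i<M. ennreal (w i * gauss_dens d (mustar i) x) * ?f x)"
      using w_pos gauss_dens_pos
      by (subst sum_ennreal[symmetric]) (auto simp: sum_distrib_right less_imp_le)
    also have "\<dots> = (\<Sum>i<M. ennreal (w i) * (\<Prod>k<d. ?g i k (x k)))"
    proof (intro sum.cong refl)
      fix i assume "i \<in> {..<M}"
      then have "0 \<le> w i" using w_pos by (auto intro: less_imp_le)
      then show "ennreal (w i * gauss_dens d (mustar i) x) * ?f x = ennreal (w i) * (\<Prod>k<d. ?g i k (x k))"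
        by (simp add: gauss_dens_eq_prod exp_sum ennreal_mult prod_nonneg prod.distrib mult.assoc
            flip: prod_ennreal)
    qed
    finally show "ennreal (\<Sum>i<M. w i * gauss_dens d (mustar i) x) * ?f x
       = (\<Sum>i<M. ennreal (w i) * (\<Prod>k<d. ?g i k (x k)))" .
  qed
  also have "\<dots> = (\<Sum>i<M. ennreal (w i) * (\<integral>\<^sup>+x. (\<Prod>k<d. ?g i k (x k)) \<partial>?L))"
    by (subst nn_integral_sum) (auto simp: nn_integral_cmult)
  also have "\<dots> = (\<Sum>i<M. ennreal (w i) * (\<Prod>k<d. \<integral>\<^sup>+y. ?g i k y \<partial>lborel))"
    by (intro sum.cong refl arg_cong2[where f = "(*)"] L.product_nn_integral_prod) auto
  also have "\<dots> = (\<Sum>i<M. ennreal (w i * exp (\<Sum>k<d. u k * mustar i k + (u k)\<^sup>2 / 2)))"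
    using w_pos by (intro sum.cong refl)
      (simp add: normal_mgf exp_sum prod_ennreal ennreal_mult prod_nonneg less_imp_le)
  also have "\<dots> = ennreal (\<Sum>i<M. w i * exp (\<Sum>k<d. u k * mustar i k + (u k)\<^sup>2 / 2))"
    using w_pos by (intro sum_ennreal) (auto intro: less_imp_le)
  finally show ?thesis .
qed

text \<open>The total mass is the exponential moment at \<open>u = 0\<close>, where component
  \<open>i\<close> contributes \<open>w i\<close>.\<close>

sublocale prob_space P
proof
  show "emeasure P (space P) = 1"
    using gmm_mgf[of "\<lambda>_. 0"] by (simp add: w_sum)
qed

text \<open>Each component contributes a Gaussian term and a mean shift of at most
  \<open>|h| D\<close>. The shift is linear in \<open>h\<close>; completing the square bounds it by
  \<open>D^2 h^2 + 1/4\<close>, hence the prefactor \<open>exp (1/4)\<close> and the variance proxy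
  \<open>1 + 2 D^2\<close>.\<close>

lemma gmm_linear_mgf_le:
  assumes m: "\<And>i. i < M \<Longrightarrow> vnorm d (\<lambda>k. mustar i k - m k) \<le> D" and "vnorm d u \<le> 1" "0 \<le> D"
  shows "(\<integral>\<^sup>+x. ennreal (exp (h * (\<Sum>k<d. u k * (x k - m k)))) \<partial>P)
    \<le> ennreal (exp (1 / 4) * exp ((1 + 2 * D\<^sup>2) * h\<^sup>2 / 2))"
proof -
  let ?c = "exp (- h * (\<Sum>k<d. u k * m k))"
  have "(\<integral>\<^sup>+x. ennreal (exp (h * (\<Sum>k<d. u k * (x k - m k)))) \<partial>P)
     = (\<integral>\<^sup>+x. ennreal ?c * ennreal (exp (\<Sum>k<d. h * u k * x k)) \<partial>P)"
    by (intro nn_integral_cong)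
       (simp add: algebra_simps sum_subtractf sum_negf sum_distrib_left flip: ennreal_mult exp_add)
  also have "\<dots> = ennreal ?c * (\<integral>\<^sup>+x. ennreal (exp (\<Sum>k<d. (h * u k) * x k)) \<partial>P)"
    by (rule nn_integral_cmult) measurable
  also have "\<dots> = ennreal (\<Sum>i<M. w i * (?c * exp (\<Sum>k<d. h * u k * mustar i k + (h * u k)\<^sup>2 / 2)))"
    unfolding gmm_mgf by (simp add: sum_distrib_left mult.left_commute flip: ennreal_mult')
  also have "\<dots> \<le> ennreal (\<Sum>i<M. w i * (exp (1 / 4) * exp ((1 + 2 * D\<^sup>2) * h\<^sup>2 / 2)))"
  proof (intro ennreal_leI sum_mono mult_left_mono)
    fix i assume i: "i \<in> {..<M}"
    let ?q = "\<Sum>k<d. u k * (mustar i k - m k)"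
    have "\<bar>?q\<bar> \<le> vnorm d u * vnorm d (\<lambda>k. mustar i k - m k)"
      by (rule vnorm_cauchy_schwarz)
    also have "\<dots> \<le> 1 * D"
      using m i assms by (intro mult_mono) auto
    finally have q: "\<bar>?q\<bar> \<le> D" by simp
    have u2: "(\<Sum>k<d. (u k)\<^sup>2) \<le> 1"
      using power_mono[OF assms(2), of 2] by (simp add: vnorm_power2)
    have "h * ?q \<le> \<bar>h\<bar> * \<bar>?q\<bar>" by (metis abs_ge_self abs_mult)
    also have "\<dots> \<le> \<bar>h\<bar> * D" using q by (intro mult_left_mono) auto
    also have "\<dots> \<le> D\<^sup>2 * h\<^sup>2 + 1 / 4"
    proof -
      have "0 \<le> (\<bar>h\<bar> * D - 1 / 2)\<^sup>2" by simp
      then show ?thesis by (simp add: power2_eq_square algebra_simps)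
    qed
    finally have 1: "h * ?q \<le> D\<^sup>2 * h\<^sup>2 + 1 / 4" .
    have 2: "h\<^sup>2 * (\<Sum>k<d. (u k)\<^sup>2) / 2 \<le> h\<^sup>2 * 1 / 2"
      using u2 by (intro divide_right_mono mult_left_mono) auto
    have "- h * (\<Sum>k<d. u k * m k) + (\<Sum>k<d. h * u k * mustar i k + (h * u k)\<^sup>2 / 2)
      = h * ?q + h\<^sup>2 * (\<Sum>k<d. (u k)\<^sup>2) / 2"
      by (simp add: sum_distrib_left sum.distrib sum_subtractf sum_negf algebra_simps power_mult_distrib
          sum_divide_distrib)
    also have "\<dots> \<le> 1 / 4 + (1 + 2 * D\<^sup>2) * h\<^sup>2 / 2"
    proof -
      have "(1 + 2 * D\<^sup>2) * h\<^sup>2 / 2 = h\<^sup>2 * 1 / 2 + D\<^sup>2 * h\<^sup>2"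
        by (simp add: field_simps)
      then show ?thesis using 1 2 by linarith
    qed
    finally show "?c * exp (\<Sum>k<d. h * u k * mustar i k + (h * u k)\<^sup>2 / 2)
      \<le> exp (1 / 4) * exp ((1 + 2 * D\<^sup>2) * h\<^sup>2 / 2)"
      by (simp flip: exp_add)
  next
    fix i assume "i \<in> {..<M}"
    then show "0 \<le> w i" using w_pos by (auto intro: less_imp_le)
  qed
  also have "\<dots> = ennreal (exp (1 / 4) * exp ((1 + 2 * D\<^sup>2) * h\<^sup>2 / 2))"
    unfolding sum_distrib_right[symmetric] w_sum by simp
  finally show ?thesis .
qed

lemma gmm_psi2:
  assumes m: "\<And>i. i < M \<Longrightarrow> vnorm d (\<lambda>k. mustar i k - m k) \<le> D" and u: "vnorm d u \<le> 1" and "1 \<le> D"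
    and Y: "\<And>x. \<bar>Y x\<bar> \<le> \<bar>\<Sum>k<d. u k * (x k - m k)\<bar>"
  shows "(\<integral>\<^sup>+x. ennreal (exp ((Y x)\<^sup>2 / (sqrt 12 * D)\<^sup>2)) \<partial>P) \<le> 2"
proof -
  let ?Z = "\<lambda>x. \<Sum>k<d. u k * (x k - m k)"
  define \<sigma> where "\<sigma> = sqrt (1 + 2 * D\<^sup>2)"
  have \<sigma>: "\<sigma> > 0" "\<sigma>\<^sup>2 = 1 + 2 * D\<^sup>2"
    by (auto simp: \<sigma>_def add_pos_nonneg)
  \<comment> \<open>The fourth power of the left side is \<open>4 e\<close>, which is below 16; this
    is why the slack \<open>1/4\<close> was chosen in the mean shift.\<close>
  have "exp (1 / 4 :: real) * sqrt 2 \<le> 2"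
  proof -
    have "sqrt 2 ^ 4 = (4 :: real)"
      using power_mult[of "sqrt 2" 2 2] by simp
    then have "(exp (1 / 4) * sqrt 2) ^ 4 = exp (1::real) * 4"
      by (simp add: power_mult_distrib flip: exp_of_nat_mult)
    also have "\<dots> \<le> 2 ^ 4" using exp_le by simp
    finally show ?thesis by (rule power_le_imp_le_base[where n = 3, simplified]) auto
  qed
  have D: "1 \<le> D\<^sup>2" using \<open>1 \<le> D\<close> by (simp add: one_le_power)
  \<comment> \<open>The linear form is treated as a vector of dimension one, so the norm lemma
    applies with a single coordinate. The 12 comes from
    \<open>4 \<sigma>^2 = 4 + 8 D^2 <= 12 D^2\<close>.\<close>
  have "(\<integral>\<^sup>+x. ennreal (exp ((Y x)\<^sup>2 / (sqrt 12 * D)\<^sup>2)) \<partial>P)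
     \<le> (\<integral>\<^sup>+x. ennreal (exp ((\<Sum>k<Suc 0. (?Z x)\<^sup>2) / (4 * \<sigma>\<^sup>2))) \<partial>P)"
  proof (intro nn_integral_mono ennreal_leI)
    fix x
    have "(Y x)\<^sup>2 / (sqrt 12 * D)\<^sup>2 \<le> (?Z x)\<^sup>2 / (sqrt 12 * D)\<^sup>2"
      using Y[of x] by (intro divide_right_mono) (auto simp: abs_le_square_iff)
    also have "\<dots> \<le> (?Z x)\<^sup>2 / (4 * \<sigma>\<^sup>2)"
      using D by (intro divide_left_mono) (auto simp: power_mult_distrib \<sigma> add_pos_nonneg intro!: mult_pos_pos)
    finally show "exp ((Y x)\<^sup>2 / (sqrt 12 * D)\<^sup>2) \<le> exp ((\<Sum>k<Suc 0. (?Z x)\<^sup>2) / (4 * \<sigma>\<^sup>2))"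
      by simp
  qed
  also have "\<dots> \<le> ennreal (exp (1 / 4) * sqrt 2 ^ Suc 0)"
  proof (rule nn_integral_exp_norm_square_le)
    fix v :: "nat \<Rightarrow> real"
    show "(\<integral>\<^sup>+x. ennreal (exp (\<Sum>k<Suc 0. v k * ?Z x)) \<partial>P)
       \<le> ennreal (exp (1 / 4) * exp (\<sigma>\<^sup>2 * (\<Sum>k<Suc 0. (v k)\<^sup>2) / 2))"
      using gmm_linear_mgf_le[OF m u, where h = "v 0"] \<open>1 \<le> D\<close> by (simp add: \<sigma>)
  qed (use \<sigma> sigma_finite_measure_axioms in auto)
  also have "\<dots> \<le> 2"
    using \<open>exp (1 / 4 :: real) * sqrt 2 \<le> 2\<close> ennreal_leI by fastforce
  finally show ?thesis .
qed

section \<open>Vectors \<open>x - m\<close> scaled by a bounded factor \<open>h\<close>: a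
  responsibility, or the constant 1\<close>

context
  fixes h :: "(nat \<Rightarrow> real) \<Rightarrow> real" and m :: "nat \<Rightarrow> real" and D :: real
  assumes h_meas [measurable]: "h \<in> borel_measurable P" and h_le: "\<And>x. \<bar>h x\<bar> \<le> 1"
    and m: "\<And>i. i < M \<Longrightarrow> vnorm d (\<lambda>k. mustar i k - m k) \<le> D" and D: "1 \<le> D"
begin

lemma weighted_psi2:
  assumes "vnorm d u \<le> 1"
  shows "(\<integral>\<^sup>+x. ennreal (exp ((\<Sum>k<d. u k * (h x * (x k - m k)))\<^sup>2 / (sqrt 12 * D)\<^sup>2)) \<partial>P) \<le> 2"
proof (rule gmm_psi2[OF m assms D])
  fix x
  have "(\<Sum>k<d. u k * (h x * (x k - m k))) = h x * (\<Sum>k<d. u k * (x k - m k))"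
    by (simp add: sum_distrib_left mult.left_commute)
  then show "\<bar>\<Sum>k<d. u k * (h x * (x k - m k))\<bar> \<le> \<bar>\<Sum>k<d. u k * (x k - m k)\<bar>"
    using h_le[of x] by (simp add: abs_mult mult_left_le_one_le)
qed

lemma weighted_coordinate:
  assumes "k < d"
  shows weighted_integrable: "integrable P (\<lambda>x. h x * (x k - m k))"
    and weighted_integrable_square: "integrable P (\<lambda>x. (h x * (x k - m k))\<^sup>2)"
    and weighted_second_moment: "(\<integral>x. (h x * (x k - m k))\<^sup>2 \<partial>P) \<le> 12 * D\<^sup>2"
proof -
  define u where "u = (\<lambda>l. if l = k then 1 else 0 :: real)"
  have "vnorm d u \<le> 1"
    using assms by (simp add: vnorm_def u_def if_distrib[of "\<lambda>y. y\<^sup>2"] cong: if_cong)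
  moreover have "(\<Sum>l<d. u l * (h x * (x l - m l))) = h x * (x k - m k)" for x
    using assms by (simp add: u_def if_distrib[of "\<lambda>y. y * _"] cong: if_cong)
  ultimately have psi: "(\<integral>\<^sup>+x. ennreal (exp ((h x * (x k - m k))\<^sup>2 / (sqrt 12 * D)\<^sup>2)) \<partial>P) \<le> 2"
    using weighted_psi2[of u] by simp
  have "(\<lambda>x. h x * (x k - m k)) \<in> borel_measurable P" "sqrt 12 * D > 0"
    using assms D by auto
  from psi2_moments[OF this psi]
  show "integrable P (\<lambda>x. h x * (x k - m k))" "integrable P (\<lambda>x. (h x * (x k - m k))\<^sup>2)"
    "(\<integral>x. (h x * (x k - m k))\<^sup>2 \<partial>P) \<le> 12 * D\<^sup>2"
    by (auto simp: power_mult_distrib)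
qed

lemma weighted_expectation_linear:
  "(\<integral>x. (\<Sum>k<d. u k * (h x * (x k - m k))) \<partial>P) = (\<Sum>k<d. u k * (\<integral>x. h x * (x k - m k) \<partial>P))"
  using weighted_integrable by (subst Bochner_Integration.integral_sum) auto

lemma weighted_expectation_norm_le:
  "vnorm d (\<lambda>k. \<integral>x. h x * (x k - m k) \<partial>P) \<le> sqrt 12 * D"
proof (rule vnorm_le_by_duality)
  fix u assume u: "vnorm d u \<le> 1"
  have "\<bar>\<integral>x. (\<Sum>k<d. u k * (h x * (x k - m k))) \<partial>P\<bar> \<le> sqrt 12 * D"
    by (rule psi2_abs_expectation[OF _ _ weighted_psi2[OF u]]) (use D in auto)
  then show "(\<Sum>k<d. u k * (\<integral>x. h x * (x k - m k) \<partial>P)) \<le> sqrt 12 * D"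
    unfolding weighted_expectation_linear by linarith
qed (use D in auto)

text \<open>Scaling \<open>u\<close> to a unit vector reduces to the scalar bound with
  \<open>K = sqrt 12 * D\<close> and \<open>l = |u|\<close>; the variance proxy is
  \<open>2 * 4 * 12 D^2 = 96 D^2\<close>.\<close>

lemma weighted_centered_mgf:
  "(\<integral>\<^sup>+x. ennreal (exp (\<Sum>k<d. u k * (h x * (x k - m k) - (\<integral>x. h x * (x k - m k) \<partial>P)))) \<partial>P)
    \<le> ennreal (exp (96 * D\<^sup>2 * (\<Sum>k<d. (u k)\<^sup>2) / 2))"
proof (cases "vnorm d u = 0")
  case True
  then have "\<forall>k<d. u k = 0"
    by (simp add: vnorm_eq_L2_set L2_set_eq_0_iff)
  then show ?thesis
    by (simp add: emeasure_space_1)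
next
  case False
  define l where "l = vnorm d u"
  define v where "v = (\<lambda>k. 1 / l * u k)"
  have l: "l > 0" "l\<^sup>2 = (\<Sum>k<d. (u k)\<^sup>2)"
    using False by (auto simp: l_def vnorm_power2 order_less_le)
  have v: "vnorm d v \<le> 1"
    unfolding v_def vnorm_scale using l by (simp add: l_def)
  have uv: "u k = l * v k" for k
    using l by (simp add: v_def)
  let ?Y = "\<lambda>x. \<Sum>k<d. v k * (h x * (x k - m k))"
  have "(\<Sum>k<d. u k * (h x * (x k - m k) - (\<integral>x. h x * (x k - m k) \<partial>P)))
    = l * (?Y x - expectation ?Y)" for x
    unfolding weighted_expectation_linear
    by (simp add: uv sum_distrib_left right_diff_distrib sum_subtractf mult.assoc)
  then have "(\<integral>\<^sup>+x. ennreal (exp (\<Sum>k<d. u k * (h x * (x k - m k) - (\<integral>x. h x * (x k - m k) \<partial>P)))) \<partial>P)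
    = (\<integral>\<^sup>+x. ennreal (exp (l * (?Y x - expectation ?Y))) \<partial>P)"
    by simp
  also have "\<dots> \<le> ennreal (exp (4 * (sqrt 12 * D)\<^sup>2 * l\<^sup>2))"
    by (rule centered_mgf_of_psi2[OF _ _ weighted_psi2[OF v]]) (use D in auto)
  also have "\<dots> = ennreal (exp (96 * D\<^sup>2 * (\<Sum>k<d. (u k)\<^sup>2) / 2))"
    by (simp add: power_mult_distrib l)
  finally show ?thesis .
qed

text \<open>Independence multiplies the exponential moments, so the proxy is \<open>96 D^2 n\<close>
  and the tail denominator four times that. Subsets \<open>S\<close> are allowed because three
  choices occur later: the whole sample, a single index, and all subsets at once.\<close>

lemma sample_sum_tail:
  assumes "1 \<le> n" "S \<subseteq> {..<n}" "0 \<le> t"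
  defines "Q \<equiv> PiM {..<n} (\<lambda>_. P)"
  shows "{X \<in> space Q. t \<le> vnorm d (\<lambda>k. \<Sum>j\<in>S. h (X j) * (X j k - m k) - (\<integral>x. h x * (x k - m k) \<partial>P))} \<in> sets Q"
    and "measure Q {X \<in> space Q. t \<le> vnorm d (\<lambda>k. \<Sum>j\<in>S. h (X j) * (X j k - m k) - (\<integral>x. h x * (x k - m k) \<partial>P))}
      \<le> sqrt 2 ^ d * exp (- t\<^sup>2 / (384 * D\<^sup>2 * real n))"
proof -
  define f where "f = (\<lambda>k x. h x * (x k - m k) - (\<integral>x. h x * (x k - m k) \<partial>P))"
  have f [measurable]: "f k \<in> borel_measurable P" if "k < d" for k
    unfolding f_def using that by measurable
  have comp: "(\<lambda>X. X j) \<in> measurable Q P" if "j < n" for j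
    unfolding Q_def using that by (intro measurable_component_singleton) auto
  have fX [measurable]: "(\<lambda>X. f k (X j)) \<in> borel_measurable Q" if "k < d" "j < n" for j k
    using measurable_compose[OF comp f] that by simp
  have finS: "finite S" using assms(2) finite_subset by blast
  have meas: "(\<lambda>X. \<Sum>j\<in>S. f k (X j)) \<in> borel_measurable Q" if "k < d" for k
    using assms(2) that by (intro borel_measurable_sum fX) auto
  interpret Qp: product_prob_space "\<lambda>_::nat. P" "{..<n}"
    by (rule product_prob_spaceI) (rule prob_space_axioms)
  interpret Q: prob_space Q
    unfolding Q_def by (rule prob_space_PiM) (rule prob_space_axioms)
  have vm: "(\<lambda>X. vnorm d (\<lambda>k. \<Sum>j\<in>S. f k (X j))) \<in> borel_measurable Q"
    unfolding vnorm_def using meas by measurable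
  have "{X \<in> space Q. t \<le> vnorm d (\<lambda>k. \<Sum>j\<in>S. f k (X j))} \<in> sets Q"
    using vm by measurable
  then show "{X \<in> space Q. t \<le> vnorm d (\<lambda>k. \<Sum>j\<in>S. h (X j) * (X j k - m k) - (\<integral>x. h x * (x k - m k) \<partial>P))} \<in> sets Q"
    by (simp add: f_def)
  define \<sigma> where "\<sigma> = sqrt (96 * D\<^sup>2 * real n)"
  have \<sigma>: "\<sigma> > 0" "\<sigma>\<^sup>2 = 96 * D\<^sup>2 * real n"
    using D assms by (auto simp: \<sigma>_def)
  have "Q.prob {X \<in> space Q. t \<le> vnorm d (\<lambda>k. \<Sum>j\<in>S. f k (X j))} \<le> sqrt 2 ^ d * exp (- t\<^sup>2 / (4 * \<sigma>\<^sup>2))"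
  proof (rule Q.prob_norm_ge_le[OF meas \<sigma>(1) \<open>0 \<le> t\<close>])
    fix u :: "nat \<Rightarrow> real"
    \<comment> \<open>Factors outside \<open>S\<close> are set to 1 so that the product runs over
      the whole index set of \<open>Q\<close>; their integral 1 is still below the common
      bound.\<close>
    let ?e = "\<lambda>j x. if j \<in> S then ennreal (exp (\<Sum>k<d. u k * f k x)) else 1"
    have "(\<integral>\<^sup>+X. ennreal (exp (\<Sum>k<d. u k * (\<Sum>j\<in>S. f k (X j)))) \<partial>Q)
       = (\<integral>\<^sup>+X. (\<Prod>j<n. ?e j (X j)) \<partial>Q)"
    proof (rule nn_integral_cong)
      fix X
      have "(\<Sum>k<d. u k * (\<Sum>j\<in>S. f k (X j))) = (\<Sum>j\<in>S. \<Sum>k<d. u k * f k (X j))"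
        unfolding sum_distrib_left by (rule sum.swap)
      then have "ennreal (exp (\<Sum>k<d. u k * (\<Sum>j\<in>S. f k (X j))))
        = (\<Prod>j\<in>S. ennreal (exp (\<Sum>k<d. u k * f k (X j))))"
        using finS by (simp only: exp_sum prod_ennreal exp_ge_zero)
      also have "\<dots> = (\<Prod>j<n. ?e j (X j))"
        using assms(2) by (subst prod.inter_restrict[symmetric]) (auto simp: Int_absorb1)
      finally show "ennreal (exp (\<Sum>k<d. u k * (\<Sum>j\<in>S. f k (X j)))) = (\<Prod>j<n. ?e j (X j))" .
    qed
    also have "\<dots> = (\<Prod>j<n. \<integral>\<^sup>+x. ?e j x \<partial>P)"
      unfolding Q_def by (rule Qp.product_nn_integral_prod) auto
    also have "\<dots> \<le> (\<Prod>j<n. ennreal (exp (96 * D\<^sup>2 * (\<Sum>k<d. (u k)\<^sup>2) / 2)))"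
    proof (intro prod_mono_ennreal)
      fix j
      have "(1::ennreal) \<le> ennreal (exp (96 * D\<^sup>2 * (\<Sum>k<d. (u k)\<^sup>2) / 2))"
        by (simp add: sum_nonneg)
      then show "(\<integral>\<^sup>+x. ?e j x \<partial>P) \<le> ennreal (exp (96 * D\<^sup>2 * (\<Sum>k<d. (u k)\<^sup>2) / 2))"
        using weighted_centered_mgf[of u]
        by (cases "j \<in> S") (auto simp: f_def emeasure_space_1)
    qed
    also have "\<dots> = ennreal (exp (\<sigma>\<^sup>2 * (\<Sum>k<d. (u k)\<^sup>2) / 2))"
      by (simp add: \<sigma> ennreal_power algebra_simps flip: exp_of_nat_mult)
    finally show "(\<integral>\<^sup>+X. ennreal (exp (\<Sum>k<d. u k * (\<Sum>j\<in>S. f k (X j)))) \<partial>Q)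
      \<le> ennreal (exp (\<sigma>\<^sup>2 * (\<Sum>k<d. (u k)\<^sup>2) / 2))" .
  qed
  then show "measure Q {X \<in> space Q. t \<le> vnorm d (\<lambda>k. \<Sum>j\<in>S. h (X j) * (X j k - m k) - (\<integral>x. h x * (x k - m k) \<partial>P))}
      \<le> sqrt 2 ^ d * exp (- t\<^sup>2 / (384 * D\<^sup>2 * real n))"
    by (simp add: f_def \<sigma> mult.assoc)
qed

end

end

subsection \<open>Stability of the weighted residuals\<close>

text \<open>For a fixed direction \<open>u\<close> the sum is linear in the weights, hence largest
  when \<open>r j\<close> is 1 exactly where \<open><u, v j>\<close> is positive. That choice is a
  subset \<open>S\<close>, whose dependence on \<open>u\<close> is harmless since all subsets are
  controlled.\<close>

lemma vnorm_weighted_sum_le: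
  assumes "finite J" and r: "\<And>j. j \<in> J \<Longrightarrow> 0 \<le> r j" "\<And>j. j \<in> J \<Longrightarrow> r j \<le> 1" and "0 \<le> t"
    and S: "\<And>S. S \<subseteq> J \<Longrightarrow> vnorm d (\<lambda>k. \<Sum>j\<in>S. v j k) \<le> t"
  shows "vnorm d (\<lambda>k. \<Sum>j\<in>J. r j * v j k) \<le> t"
proof (rule vnorm_le_by_duality[OF \<open>0 \<le> t\<close>])
  fix u assume u: "vnorm d u \<le> 1"
  define q where "q = (\<lambda>j. \<Sum>k<d. u k * v j k)"
  define S where "S = {j \<in> J. 0 < q j}"
  have "(\<Sum>k<d. u k * (\<Sum>j\<in>J. r j * v j k)) = (\<Sum>k<d. \<Sum>j\<in>J. r j * (u k * v j k))"
    by (simp add: sum_distrib_left mult.left_commute)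
  also have "\<dots> = (\<Sum>j\<in>J. r j * q j)"
    unfolding q_def sum_distrib_left by (rule sum.swap)
  also have "\<dots> \<le> (\<Sum>j\<in>J. if 0 < q j then q j else 0)"
    using r by (intro sum_mono) (auto simp: mult_left_le_one_le mult_nonneg_nonpos)
  also have "\<dots> = (\<Sum>j\<in>S. q j)"
    unfolding S_def using \<open>finite J\<close> by (rule sum.inter_filter[symmetric])
  also have "\<dots> = (\<Sum>k<d. u k * (\<Sum>j\<in>S. v j k))"
    unfolding q_def sum_distrib_left by (rule sum.swap)
  also have "\<dots> \<le> vnorm d u * vnorm d (\<lambda>k. \<Sum>j\<in>S. v j k)"
    using vnorm_cauchy_schwarz[of u "\<lambda>k. \<Sum>j\<in>S. v j k" d] by linarith
  also have "\<dots> \<le> 1 * t"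
    using u S[of S] by (intro mult_mono) (auto simp: S_def)
  finally show "(\<Sum>k<d. u k * (\<Sum>j\<in>J. r j * v j k)) \<le> t" by simp
qed

text \<open>Each Gaussian density changes by a factor at most \<open>exp \<eta>\<close>, so
  numerator and denominator together change the responsibility by at most
  \<open>exp (2 \<eta>)\<close>. Since responsibilities are at most 1, the additive change is at
  most \<open>1 - exp (- 2 \<eta>) <= 2 \<eta>\<close>. Exchanging \<open>mu\<close> and
  \<open>nu\<close> gives the other sign.\<close>

lemma resp_diff_le:
  assumes w: "\<forall>j<M. 0 < w j" and "i < M"
    and \<eta>: "\<And>j. j < M \<Longrightarrow> \<bar>(vnorm d (\<lambda>k. x k - mu j k))\<^sup>2 - (vnorm d (\<lambda>k. x k - nu j k))\<^sup>2\<bar> \<le> 2 * \<eta>"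
  shows "\<bar>resp M d w mu i x - resp M d w nu i x\<bar> \<le> 2 * \<eta>"
proof -
  have *: "resp M d w mu i x - resp M d w nu i x \<le> 2 * \<eta>"
    if \<eta>: "\<And>j. j < M \<Longrightarrow> \<bar>(vnorm d (\<lambda>k. x k - mu j k))\<^sup>2 - (vnorm d (\<lambda>k. x k - nu j k))\<^sup>2\<bar> \<le> 2 * \<eta>"
    for mu nu
  proof -
    have ratio: "gauss_dens d m x \<le> exp \<eta> * gauss_dens d m' x"
      if "(vnorm d (\<lambda>k. x k - m' k))\<^sup>2 - (vnorm d (\<lambda>k. x k - m k))\<^sup>2 \<le> 2 * \<eta>" for m m'
    proof -
      have "exp (- (vnorm d (\<lambda>k. x k - m k))\<^sup>2 / 2) \<le> exp (\<eta> + - (vnorm d (\<lambda>k. x k - m' k))\<^sup>2 / 2)"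
        using that by simp
      also have "\<dots> = exp \<eta> * exp (- (vnorm d (\<lambda>k. x k - m' k))\<^sup>2 / 2)"
        by (rule exp_add)
      finally show ?thesis
        by (simp add: gauss_dens_def vnorm_power2 mult_left_mono mult.left_commute)
    qed
    let ?t = "\<lambda>mu j. w j * gauss_dens d (mu j) x"
    have pos: "0 < ?t mu j" if "j < M" for j mu
      using w that gauss_dens_pos by simp
    have Spos: "0 < (\<Sum>j<M. ?t mu j)" for mu
      using \<open>i < M\<close> pos by (intro sum_pos) auto
    have t: "?t mu i \<le> exp \<eta> * ?t nu i"
    proof -
      have "gauss_dens d (mu i) x \<le> exp \<eta> * gauss_dens d (nu i) x"
        using \<eta>[OF \<open>i < M\<close>] by (intro ratio) linarith
      then show ?thesis
        using w \<open>i < M\<close> by (simp add: mult.left_commute)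
    qed
    have S: "(\<Sum>j<M. ?t nu j) \<le> exp \<eta> * (\<Sum>j<M. ?t mu j)"
    proof -
      have "?t nu j \<le> exp \<eta> * ?t mu j" if "j < M" for j
      proof -
        have "gauss_dens d (nu j) x \<le> exp \<eta> * gauss_dens d (mu j) x"
          using \<eta>[OF that] by (intro ratio) linarith
        then show ?thesis
          using w that by (simp add: mult.left_commute)
      qed
      then show ?thesis unfolding sum_distrib_left by (intro sum_mono) auto
    qed
    define r where "r = resp M d w mu i x"
    define r' where "r' = resp M d w nu i x"
    have r01: "0 \<le> r" "r \<le> 1" "0 \<le> r'"
      using resp_nonneg_le_1[OF w \<open>i < M\<close>] by (auto simp: r_def r'_def)
    have "r \<le> (exp \<eta> * ?t nu i) / (\<Sum>j<M. ?t mu j)"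
      unfolding r_def resp_def using t Spos[of mu] by (intro divide_right_mono) auto
    also have "\<dots> \<le> (exp \<eta> * ?t nu i) / ((\<Sum>j<M. ?t nu j) / exp \<eta>)"
      using S Spos pos[OF \<open>i < M\<close>, of nu]
      by (intro divide_left_mono) (auto simp: divide_le_eq mult.commute)
    also have "\<dots> = exp (2 * \<eta>) * r'"
      by (simp add: r'_def resp_def mult_exp_exp)
    finally have "exp (- (2 * \<eta>)) * r \<le> r'"
      by (simp add: exp_minus field_simps)
    then have "r - r' \<le> (1 - exp (- (2 * \<eta>))) * r"
      by (simp add: algebra_simps)
    also have "\<dots> \<le> 2 * \<eta> * r"
    proof (rule mult_right_mono)
      show "1 - exp (- (2 * \<eta>)) \<le> 2 * \<eta>"
        using exp_ge_add_one_self[of "- (2 * \<eta>)"] by linarith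
    qed (use r01 in auto)
    also have "\<dots> \<le> 2 * \<eta> * 1"
      using r01 order_trans[OF abs_ge_zero \<eta>[OF \<open>i < M\<close>]] by (intro mult_left_mono)
    finally show ?thesis by (simp add: r_def r'_def)
  qed
  have "resp M d w nu i x - resp M d w mu i x \<le> 2 * \<eta>"
    using \<eta> by (intro *) (simp add: abs_minus_commute)
  with *[of mu nu, OF \<eta>] show ?thesis by linarith
qed

text \<open>Splits the change into that of the responsibility times \<open>x - mu i\<close> and the
  responsibility times the shift of the center. A difference of squared distances factors into at
  most \<open>\<delta>\<close> times \<open>2 T\<close>, which makes the first part quadratic in
  \<open>|x|\<close>.\<close>

lemma weighted_residual_diff_le:
  assumes w: "\<forall>j<M. 0 < w j" and "i < M" and "0 \<le> \<delta>"
    and mu: "\<And>j. j < M \<Longrightarrow> vnorm d (mu j) \<le> B" and nu: "\<And>j. j < M \<Longrightarrow> vnorm d (nu j) \<le> B"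
    and close: "\<And>j. j < M \<Longrightarrow> vnorm d (\<lambda>k. mu j k - nu j k) \<le> \<delta>"
  shows "vnorm d (\<lambda>k. resp M d w mu i x * (x k - mu i k) - resp M d w nu i x * (x k - nu i k))
    \<le> \<delta> * (2 * (vnorm d x + B)\<^sup>2 + 1)"
proof -
  define T where "T = vnorm d x + B"
  have "0 \<le> B" using mu[OF \<open>i < M\<close>] vnorm_nonneg order_trans by blast
  then have "0 \<le> T" by (simp add: T_def)
  have bound: "vnorm d (\<lambda>k. x k - m k) \<le> T" if "vnorm d m \<le> B" for m
    using vnorm_diff_le[of d x m] that by (simp add: T_def)
  have r: "\<bar>resp M d w mu i x - resp M d w nu i x\<bar> \<le> 2 * (\<delta> * T)"
  proof (rule resp_diff_le[OF w \<open>i < M\<close>])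
    fix j assume j: "j < M"
    let ?a = "vnorm d (\<lambda>k. x k - mu j k)" and ?b = "vnorm d (\<lambda>k. x k - nu j k)"
    have "\<bar>?a - ?b\<bar> \<le> \<delta>"
      using vnorm_diff_triangle[of d x "mu j" "nu j"] vnorm_diff_triangle[of d x "nu j" "mu j"]
        vnorm_diff_commute[of d "mu j" "nu j"] close[OF j] by linarith
    moreover have "?a + ?b \<le> 2 * T" "0 \<le> ?a + ?b"
      using bound[OF mu[OF j]] bound[OF nu[OF j]] by auto
    ultimately have "\<bar>?a - ?b\<bar> * \<bar>?a + ?b\<bar> \<le> \<delta> * (2 * T)"
      using \<open>0 \<le> \<delta>\<close> by (intro mult_mono) auto
    moreover have "?a\<^sup>2 - ?b\<^sup>2 = (?a - ?b) * (?a + ?b)"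
      by (simp add: power2_eq_square algebra_simps)
    ultimately show "\<bar>?a\<^sup>2 - ?b\<^sup>2\<bar> \<le> 2 * (\<delta> * T)"
      by (simp add: abs_mult)
  qed
  have "vnorm d (\<lambda>k. resp M d w mu i x * (x k - mu i k) - resp M d w nu i x * (x k - nu i k))
    = vnorm d (\<lambda>k. (resp M d w mu i x - resp M d w nu i x) * (x k - mu i k)
        + resp M d w nu i x * (nu i k - mu i k))"
    by (intro vnorm_cong) (simp add: algebra_simps)
  also have "\<dots> \<le> \<bar>resp M d w mu i x - resp M d w nu i x\<bar> * vnorm d (\<lambda>k. x k - mu i k)
      + \<bar>resp M d w nu i x\<bar> * vnorm d (\<lambda>k. nu i k - mu i k)"
    by (rule order_trans[OF vnorm_triangle]) (simp add: vnorm_scale)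
  also have "\<dots> \<le> 2 * (\<delta> * T) * T + 1 * \<delta>"
    using r bound[OF mu[OF \<open>i < M\<close>]] resp_nonneg_le_1[OF w \<open>i < M\<close>, of d nu x] close[OF \<open>i < M\<close>]
      \<open>0 \<le> T\<close> \<open>0 \<le> \<delta>\<close> vnorm_diff_commute[of d "mu i" "nu i"]
    by (intro add_mono mult_mono) auto
  also have "\<dots> = \<delta> * (2 * (vnorm d x + B)\<^sup>2 + 1)"
    by (simp add: T_def power2_eq_square algebra_simps)
  finally show ?thesis .
qed

text \<open>\<open>R\<close> will be \<open>Rmax\<close>. Keeping it abstract isolates what the
  concentration argument uses of the geometry: all true centers lie in a ball about the
  origin.\<close>

locale gmm_bounded = gmm_model +
  fixes R :: real
  assumes R_nonneg: "0 \<le> R" and mustar_le: "\<And>i. i < M \<Longrightarrow> vnorm d (mustar i) \<le> R"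
begin

abbreviation D where "D \<equiv> 1 + 3 * R"

lemma D_ge_1: "1 \<le> D"
  using R_nonneg by simp

lemma mustar_diff_le: "i < M \<Longrightarrow> vnorm d m \<le> 2 * R + 1 \<Longrightarrow> vnorm d (\<lambda>k. mustar i k - m k) \<le> D"
  using vnorm_diff_le[of d "mustar i" m] mustar_le[of i] by linarith

lemma resp_abs_le_1: "i < M \<Longrightarrow> \<bar>resp M d w mu i x\<bar> \<le> 1"
  using resp_nonneg_le_1[OF w_pos, of i d mu x] by simp

lemma G_pop_norm_le:
  assumes "i < M" "vnorm d (mu i) \<le> 2 * R + 1"
  shows "vnorm d (G_pop M d w mustar mu i) \<le> sqrt 12 * D"
  unfolding G_pop_def[abs_def]
  by (rule weighted_expectation_norm_le[OF resp_measurable resp_abs_le_1[OF assms(1)]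
      mustar_diff_le[OF _ assms(2)] D_ge_1])

definition mean where "mean k = (\<integral>x. x k \<partial>P)"

lemmas coordinate_moments =
  weighted_coordinate[where h = "\<lambda>_. 1" and m = "\<lambda>_. 0", simplified, OF order_trans[OF mustar_le] D_ge_1]

lemma coordinate:
  assumes "k < d"
  shows "integrable P (\<lambda>x. (x k)\<^sup>2)" "(\<integral>x. (x k)\<^sup>2 \<partial>P) \<le> 12 * D\<^sup>2"
  using coordinate_moments(2,3)[OF _ _ assms] R_nonneg by auto

lemma mean_norm_le: "vnorm d mean \<le> sqrt 12 * D"
  using weighted_expectation_norm_le[where h = "\<lambda>_. 1" and m = "\<lambda>_. 0", OF _ _ mustar_diff_le D_ge_1]
    R_nonneg by (simp add: mean_def[abs_def] vnorm_0)

lemma sample_tail: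
  assumes "1 \<le> n" "S \<subseteq> {..<n}" "0 \<le> t"
  defines "Q \<equiv> PiM {..<n} (\<lambda>_. P)"
  shows "{X \<in> space Q. t \<le> vnorm d (\<lambda>k. \<Sum>j\<in>S. X j k - mean k)} \<in> sets Q"
    and "measure Q {X \<in> space Q. t \<le> vnorm d (\<lambda>k. \<Sum>j\<in>S. X j k - mean k)}
      \<le> sqrt 2 ^ d * exp (- t\<^sup>2 / (384 * D\<^sup>2 * real n))"
  using sample_sum_tail[where h = "\<lambda>_. 1" and m = "\<lambda>_. 0", OF _ _ mustar_diff_le D_ge_1 assms(1-3)] R_nonneg
  by (auto simp: Q_def mean_def vnorm_0)

lemma G_tail:
  assumes "1 \<le> n" "0 \<le> t" "i < M" "vnorm d (mu i) \<le> 2 * R + 1"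
  defines "Q \<equiv> PiM {..<n} (\<lambda>_. P)"
  shows "{X \<in> space Q. t \<le> vnorm d (\<lambda>k. G_pop M d w mustar mu i k - G_emp M d w n X mu i k)} \<in> sets Q"
    and "measure Q {X \<in> space Q. t \<le> vnorm d (\<lambda>k. G_pop M d w mustar mu i k - G_emp M d w n X mu i k)}
      \<le> sqrt 2 ^ d * exp (- (real n * t\<^sup>2) / (384 * D\<^sup>2))"
proof -
  note tail = sample_sum_tail[OF resp_measurable resp_abs_le_1[OF assms(3)]
      mustar_diff_le[OF _ assms(4)] D_ge_1 assms(1) order_refl, where t = "real n * t", folded Q_def]
  have eq: "{X \<in> space Q. real n * t \<le> vnorm d (\<lambda>k. \<Sum>j<n. resp M d w mu i (X j) * (X j k - mu i k)
        - (\<integral>x. resp M d w mu i x * (x k - mu i k) \<partial>P))}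
    = {X \<in> space Q. t \<le> vnorm d (\<lambda>k. G_pop M d w mustar mu i k - G_emp M d w n X mu i k)}"
  proof -
    have "vnorm d (\<lambda>k. \<Sum>j<n. resp M d w mu i (X j) * (X j k - mu i k)
        - (\<integral>x. resp M d w mu i x * (x k - mu i k) \<partial>P))
      = vnorm d (\<lambda>k. - real n * (G_pop M d w mustar mu i k - G_emp M d w n X mu i k))" for X
      using assms(1) by (intro vnorm_cong) (simp add: G_pop_def G_emp_def sum_subtractf right_diff_distrib)
    then show ?thesis
      using assms(1) by (simp only: vnorm_scale abs_minus_cancel abs_of_nat) simp
  qed
  have nt: "0 \<le> real n * t"
    using assms(2) by simp
  show "{X \<in> space Q. t \<le> vnorm d (\<lambda>k. G_pop M d w mustar mu i k - G_emp M d w n X mu i k)} \<in> sets Q"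
    unfolding eq[symmetric] by (rule tail(1)[OF _ nt])
  have "measure Q {X \<in> space Q. t \<le> vnorm d (\<lambda>k. G_pop M d w mustar mu i k - G_emp M d w n X mu i k)}
      \<le> sqrt 2 ^ d * exp (- (real n * t)\<^sup>2 / (384 * D\<^sup>2 * real n))"
    unfolding eq[symmetric] by (rule tail(2)[OF _ nt])
  also have "- (real n * t)\<^sup>2 / (384 * D\<^sup>2 * real n) = - (real n * t\<^sup>2) / (384 * D\<^sup>2)"
    using assms(1) by (simp add: power2_eq_square)
  finally show "measure Q {X \<in> space Q. t \<le> vnorm d (\<lambda>k. G_pop M d w mustar mu i k - G_emp M d w n X mu i k)}
      \<le> sqrt 2 ^ d * exp (- (real n * t\<^sup>2) / (384 * D\<^sup>2))" .
qed

text \<open>The pointwise bound is quadratic in \<open>|x|\<close>, so the second moments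
  \<open>12 D^2\<close> per coordinate suffice. After enlarging \<open>(|x| + D)^2\<close> to
  \<open>2 |x|^2 + 2 D^2\<close> the constant is \<open>4 * 12 + 5 = 53\<close>.\<close>

lemma G_pop_diff_le:
  assumes "i < M" "0 \<le> \<delta>" "1 \<le> d"
    and mu: "\<And>j. j < M \<Longrightarrow> vnorm d (mu j) \<le> 2 * R + 1" and nu: "\<And>j. j < M \<Longrightarrow> vnorm d (nu j) \<le> 2 * R + 1"
    and close: "\<And>j. j < M \<Longrightarrow> vnorm d (\<lambda>k. mu j k - nu j k) \<le> \<delta>"
  shows "vnorm d (\<lambda>k. G_pop M d w mustar mu i k - G_pop M d w mustar nu i k) \<le> 53 * \<delta> * D\<^sup>2 * real d"
proof (rule vnorm_le_by_duality)
  show "0 \<le> 53 * \<delta> * D\<^sup>2 * real d" using assms by simp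
  fix u assume u: "vnorm d u \<le> 1"
  let ?F = "\<lambda>mu k x. resp M d w mu i x * (x k - mu i k)"
  let ?b = "\<lambda>x. \<delta> * (4 * (\<Sum>k<d. (x k)\<^sup>2) + (4 * D\<^sup>2 + 1))"
  have intmu: "integrable P (?F mu k)" if "k < d" for k
    by (rule weighted_integrable[OF resp_measurable resp_abs_le_1[OF assms(1)]
      mustar_diff_le[OF _ mu[OF assms(1)]] D_ge_1 that])
  have intnu: "integrable P (?F nu k)" if "k < d" for k
    by (rule weighted_integrable[OF resp_measurable resp_abs_le_1[OF assms(1)]
      mustar_diff_le[OF _ nu[OF assms(1)]] D_ge_1 that])
  have ib: "integrable P ?b"
    using coordinate(1)
    by (intro integrable_mult_right Bochner_Integration.integrable_add Bochner_Integration.integrable_sum) auto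
  have "(\<Sum>k<d. u k * (G_pop M d w mustar mu i k - G_pop M d w mustar nu i k))
    = (\<integral>x. (\<Sum>k<d. u k * (?F mu k x - ?F nu k x)) \<partial>P)"
    unfolding G_pop_def using intmu intnu by (subst Bochner_Integration.integral_sum) auto
  also have "\<dots> \<le> (\<integral>x. ?b x \<partial>P)"
  proof (rule integral_mono[OF _ ib])
    show "integrable P (\<lambda>x. \<Sum>k<d. u k * (?F mu k x - ?F nu k x))"
      using intmu intnu by auto
    fix x
    have "(\<Sum>k<d. u k * (?F mu k x - ?F nu k x)) \<le> vnorm d u * vnorm d (\<lambda>k. ?F mu k x - ?F nu k x)"
      using vnorm_cauchy_schwarz[of u "\<lambda>k. ?F mu k x - ?F nu k x" d] by linarith
    also have "\<dots> \<le> 1 * (\<delta> * (2 * (vnorm d x + (2 * R + 1))\<^sup>2 + 1))"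
      using u by (intro mult_mono weighted_residual_diff_le[OF w_pos] assms) auto
    also have "\<dots> \<le> ?b x"
    proof -
      have "(vnorm d x + (2 * R + 1))\<^sup>2 \<le> (vnorm d x + D)\<^sup>2"
        using R_nonneg by (intro power_mono) auto
      also have "\<dots> \<le> 2 * (vnorm d x)\<^sup>2 + 2 * D\<^sup>2"
      proof -
        have "0 \<le> (vnorm d x - D)\<^sup>2" by simp
        then show ?thesis by (simp only: power2_eq_square) (simp add: algebra_simps)
      qed
      finally show ?thesis
        using \<open>0 \<le> \<delta>\<close> by (simp add: vnorm_power2[symmetric] mult_left_mono)
    qed
    finally show "(\<Sum>k<d. u k * (?F mu k x - ?F nu k x)) \<le> ?b x" .
  qed
  also have "\<dots> = \<delta> * (4 * (\<Sum>k<d. \<integral>x. (x k)\<^sup>2 \<partial>P) + (4 * D\<^sup>2 + 1))"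
  proof -
    have "integrable P (\<lambda>x. \<Sum>k<d. (x k)\<^sup>2)"
      using coordinate(1) by auto
    then show ?thesis
      using coordinate(1) by (simp add: prob_space)
  qed
  also have "\<dots> \<le> \<delta> * (4 * (\<Sum>k<d. 12 * D\<^sup>2) + (4 * D\<^sup>2 + D\<^sup>2))"
    using coordinate(2) \<open>0 \<le> \<delta>\<close> one_le_power[OF D_ge_1, of 2]
    by (intro mult_left_mono add_mono sum_mono) auto
  also have "\<dots> = \<delta> * (48 * real d + 5) * D\<^sup>2"
    by (simp add: algebra_simps)
  also have "\<dots> \<le> \<delta> * (53 * real d) * D\<^sup>2"
    using assms by (intro mult_right_mono mult_left_mono) auto
  finally show "(\<Sum>k<d. u k * (G_pop M d w mustar mu i k - G_pop M d w mustar nu i k))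
    \<le> 53 * \<delta> * D\<^sup>2 * real d"
    by (simp add: mult_ac)
qed

lemma G_emp_diff_le:
  assumes "i < M" "0 \<le> \<delta>" "1 \<le> n"
    and mu: "\<And>j. j < M \<Longrightarrow> vnorm d (mu j) \<le> 2 * R + 1" and nu: "\<And>j. j < M \<Longrightarrow> vnorm d (nu j) \<le> 2 * R + 1"
    and close: "\<And>j. j < M \<Longrightarrow> vnorm d (\<lambda>k. mu j k - nu j k) \<le> \<delta>"
    and X: "\<And>j. j < n \<Longrightarrow> vnorm d (X j) + (2 * R + 1) \<le> T"
  shows "vnorm d (\<lambda>k. G_emp M d w n X mu i k - G_emp M d w n X nu i k) \<le> \<delta> * (2 * T\<^sup>2 + 1)"
proof -
  let ?F = "\<lambda>mu k x. resp M d w mu i x * (x k - mu i k)"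
  have "vnorm d (\<lambda>k. G_emp M d w n X mu i k - G_emp M d w n X nu i k)
    = vnorm d (\<lambda>k. (1 / real n) * (\<Sum>j<n. ?F mu k (X j) - ?F nu k (X j)))"
    by (simp add: G_emp_def right_diff_distrib sum_subtractf diff_divide_distrib)
  also have "\<dots> = (1 / real n) * vnorm d (\<lambda>k. \<Sum>j<n. ?F mu k (X j) - ?F nu k (X j))"
    by (subst vnorm_scale) simp
  also have "\<dots> \<le> (1 / real n) * (\<Sum>j<n. \<delta> * (2 * T\<^sup>2 + 1))"
  proof (intro mult_left_mono order_trans[OF vnorm_sum_le] sum_mono)
    fix j assume j: "j \<in> {..<n}"
    have "vnorm d (\<lambda>k. ?F mu k (X j) - ?F nu k (X j)) \<le> \<delta> * (2 * (vnorm d (X j) + (2 * R + 1))\<^sup>2 + 1)"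
      by (intro weighted_residual_diff_le[OF w_pos] assms)
    also have "\<dots> \<le> \<delta> * (2 * T\<^sup>2 + 1)"
      using X j \<open>0 \<le> \<delta>\<close> R_nonneg by (intro mult_left_mono add_right_mono power_mono) auto
    finally show "vnorm d (\<lambda>k. ?F mu k (X j) - ?F nu k (X j)) \<le> \<delta> * (2 * T\<^sup>2 + 1)" .
  qed auto
  also have "\<dots> = \<delta> * (2 * T\<^sup>2 + 1)"
    using \<open>1 \<le> n\<close> by simp
  finally show ?thesis .
qed

end

subsection \<open>Uniform deviation bounds\<close>

lemma (in prob_space) prob_UN_le_card:
  assumes "finite I" "\<And>i. i \<in> I \<Longrightarrow> A i \<in> events" "\<And>i. i \<in> I \<Longrightarrow> prob (A i) \<le> b"
  shows "prob (\<Union>i\<in>I. A i) \<le> real (card I) * b"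
proof -
  have "prob (\<Union>i\<in>I. A i) \<le> (\<Sum>i\<in>I. prob (A i))"
    using assms by (intro finite_measure_subadditive_finite) auto
  also have "\<dots> \<le> (\<Sum>i\<in>I. b)"
    using assms by (intro sum_mono) auto
  finally show ?thesis by simp
qed

lemma half_le_ln: "1 / 2 \<le> ln (real n)" if "2 \<le> n"
proof -
  have "exp (1 / 2 :: real) \<le> 1 + 1 / 2 + (1 / 2)\<^sup>2"
    by (rule exp_bound) auto
  also have "\<dots> \<le> real n"
    using that by (simp add: power2_eq_square)
  finally show ?thesis
    by (subst ln_ge_iff) (use that in auto)
qed

lemma abs_component_le_vnorm: "k < d \<Longrightarrow> \<bar>x k\<bar> \<le> vnorm d x"
  unfolding vnorm_def by (rule real_le_rsqrt) (auto intro: member_le_sum)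

lemma vnorm_le_sqrt_dim:
  assumes "\<And>k. k < d \<Longrightarrow> \<bar>x k\<bar> \<le> b" "0 \<le> b"
  shows "vnorm d x \<le> sqrt (real d) * b"
proof -
  have "(\<Sum>k<d. (x k)\<^sup>2) \<le> (\<Sum>k<d. b\<^sup>2)"
    using assms by (intro sum_mono) (metis abs_le_square_iff abs_of_nonneg lessThan_iff)
  then show ?thesis
    unfolding vnorm_def using assms(2) by (intro real_le_lsqrt) (auto simp: power_mult_distrib)
qed

section \<open>Coordinate grids for the stacked centers\<close>

definition grid :: "nat \<Rightarrow> nat \<Rightarrow> real \<Rightarrow> int \<Rightarrow> (nat \<Rightarrow> nat \<Rightarrow> real) set" where
  "grid M d s N = PiE {..<M} (\<lambda>_. PiE {..<d} (\<lambda>_. (\<lambda>z. real_of_int z / s) ` {- N..N}))"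

lemma finite_grid: "finite (grid M d s N)"
  unfolding grid_def by (intro finite_PiE) auto

lemma card_grid_le: "0 \<le> N \<Longrightarrow> real (card (grid M d s N)) \<le> (2 * real_of_int N + 1) ^ (d * M)"
proof -
  assume N: "0 \<le> N"
  have "card ((\<lambda>z. real_of_int z / s) ` {- N..N}) \<le> card {- N..N}"
    by (intro card_image_le) auto
  then have "real (card ((\<lambda>z. real_of_int z / s) ` {- N..N})) \<le> 2 * real_of_int N + 1"
    using N by simp
  then have "real (card ((\<lambda>z. real_of_int z / s) ` {- N..N})) ^ (d * M) \<le> (2 * real_of_int N + 1) ^ (d * M)"
    by (intro power_mono) auto
  then show ?thesis
    by (simp add: grid_def card_PiE power_mult)
qed

text \<open>Rounding each coordinate down to a multiple of \<open>1/s\<close> moves it by at most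
  \<open>1/s\<close>, hence each center by \<open>sqrt d / s\<close>.\<close>

lemma grid_approximation:
  assumes "\<And>j. j < M \<Longrightarrow> vnorm d (mu j) \<le> B" "0 < s" "B * s + 1 \<le> real_of_int N"
  obtains nu where "nu \<in> grid M d s N" "\<And>j. j < M \<Longrightarrow> vnorm d (\<lambda>k. mu j k - nu j k) \<le> sqrt (real d) / s"
proof
  define nu where "nu = (\<lambda>j\<in>{..<M}. \<lambda>k\<in>{..<d}. real_of_int \<lfloor>mu j k * s\<rfloor> / s)"
  have "\<lfloor>mu j k * s\<rfloor> \<in> {- N..N}" if "j < M" "k < d" for j k
  proof -
    have "\<bar>mu j k\<bar> \<le> B"
      using abs_component_le_vnorm[OF \<open>k < d\<close>, of "mu j"] assms(1)[OF \<open>j < M\<close>] by linarith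
    then have "\<bar>mu j k * s\<bar> \<le> B * s"
      using assms(2) by (simp add: abs_mult)
    then have "real_of_int (- N) \<le> mu j k * s" "mu j k * s \<le> real_of_int N"
      using assms(3) by auto
    then show ?thesis by (simp add: le_floor_iff floor_le_iff)
  qed
  then show "nu \<in> grid M d s N"
    unfolding grid_def nu_def restrict_PiE_iff by auto
  show "vnorm d (\<lambda>k. mu j k - nu j k) \<le> sqrt (real d) / s" if "j < M" for j
  proof -
    have "\<bar>mu j k - nu j k\<bar> \<le> 1 / s" if "k < d" for k
    proof -
      have "mu j k - nu j k = (mu j k * s - real_of_int \<lfloor>mu j k * s\<rfloor>) / s"
        using \<open>j < M\<close> that assms(2) by (simp add: nu_def field_simps)
      moreover have "\<bar>mu j k * s - real_of_int \<lfloor>mu j k * s\<rfloor>\<bar> \<le> 1"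
        by linarith
      ultimately show ?thesis
        using assms(2) by (simp add: divide_right_mono)
    qed
    then show ?thesis
      using vnorm_le_sqrt_dim[of d "\<lambda>k. mu j k - nu j k" "1 / s"] assms(2) by simp
  qed
qed

context gmm_bounded
begin

text \<open>Write \<open>X j - mu i\<close> as \<open>(X j - mean) + (mean - mu i)\<close>. The
  subset sums control the first part for any weights in \<open>[0,1]\<close>; the second costs
  \<open>4 D + 2 R\<close> and the population term \<open>4 D\<close>, together at most
  \<open>9 D\<close>.\<close>

lemma G_dev_le_of_subset_sums:
  assumes "1 \<le> n" "0 \<le> t" "i < M" "vnorm d (mu i) \<le> 2 * R"
    and S: "\<And>S. S \<subseteq> {..<n} \<Longrightarrow> vnorm d (\<lambda>k. \<Sum>j\<in>S. X j k - mean k) \<le> t"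
  shows "vnorm d (\<lambda>k. G_pop M d w mustar mu i k - G_emp M d w n X mu i k) \<le> 9 * D + t / real n"
proof -
  let ?r = "\<lambda>j. resp M d w mu i (X j)"
  have r: "0 \<le> ?r j" "?r j \<le> 1" for j
    using resp_nonneg_le_1[OF w_pos \<open>i < M\<close>] by auto
  have "sqrt 12 \<le> (4 :: real)" by (rule real_le_lsqrt) auto
  then have s12: "sqrt 12 * D \<le> 4 * D" using D_ge_1 by (intro mult_right_mono) auto
  have 1: "vnorm d (\<lambda>k. \<Sum>j<n. ?r j * (X j k - mean k)) \<le> t"
    by (rule vnorm_weighted_sum_le) (use r assms in auto)
  have "vnorm d (\<lambda>k. \<Sum>j<n. ?r j * (mean k - mu i k)) \<le> (\<Sum>j<n. vnorm d (\<lambda>k. ?r j * (mean k - mu i k)))"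
    by (rule vnorm_sum_le) simp
  also have "\<dots> \<le> (\<Sum>j<n. 4 * D + 2 * R)"
  proof (rule sum_mono)
    fix j
    have "vnorm d (\<lambda>k. ?r j * (mean k - mu i k)) \<le> 1 * vnorm d (\<lambda>k. mean k - mu i k)"
      unfolding vnorm_scale using r[of j] by (intro mult_right_mono) auto
    also have "\<dots> \<le> 4 * D + 2 * R"
      using vnorm_diff_le[of d mean "mu i"] mean_norm_le s12 assms(4) by linarith
    finally show "vnorm d (\<lambda>k. ?r j * (mean k - mu i k)) \<le> 4 * D + 2 * R" .
  qed
  finally have 2: "vnorm d (\<lambda>k. \<Sum>j<n. ?r j * (mean k - mu i k)) \<le> real n * (4 * D + 2 * R)" by simp
  have "vnorm d (G_emp M d w n X mu i) = (1 / real n) *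
      vnorm d (\<lambda>k. (\<Sum>j<n. ?r j * (X j k - mean k)) + (\<Sum>j<n. ?r j * (mean k - mu i k)))"
  proof -
    have "G_emp M d w n X mu i = (\<lambda>k. (1 / real n) *
        ((\<Sum>j<n. ?r j * (X j k - mean k)) + (\<Sum>j<n. ?r j * (mean k - mu i k))))"
      by (rule ext) (simp add: G_emp_def sum.distrib[symmetric] algebra_simps)
    then show ?thesis by (simp only: vnorm_scale) simp
  qed
  also have "\<dots> \<le> (1 / real n) * (t + real n * (4 * D + 2 * R))"
    by (intro mult_left_mono order_trans[OF vnorm_triangle] add_mono 1 2) auto
  also have "\<dots> = t / real n + (4 * D + 2 * R)"
    using \<open>1 \<le> n\<close> by (simp add: field_simps)
  finally have "vnorm d (G_emp M d w n X mu i) \<le> t / real n + (4 * D + 2 * R)" .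
  moreover have "vnorm d (G_pop M d w mustar mu i) \<le> 4 * D"
    using G_pop_norm_le[OF \<open>i < M\<close>, of mu] assms(4) s12 by linarith
  moreover have "vnorm d (\<lambda>k. G_pop M d w mustar mu i k - G_emp M d w n X mu i k)
      \<le> vnorm d (G_pop M d w mustar mu i) + vnorm d (G_emp M d w n X mu i)"
    by (rule vnorm_diff_le)
  ultimately show ?thesis
    using R_nonneg by argo
qed

text \<open>The rate delivered in both regimes. It is dominated by \<open>eps_unif 1\<close> at
  \<open>R = Rmax\<close>, as \<open>sqrt M <= M^(3/2)\<close> and the maximum with 1 is at least
  1.\<close>

definition uniform_bound :: "nat \<Rightarrow> real" where
  "uniform_bound n = D ^ 3 * sqrt (real M) * sqrt (real d * ln (real n) / real n)"

text \<open>Since \<open>n < d\<close>, the \<open>2^n\<close> subsets number at most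
  \<open>n^d\<close>, and the additive constant \<open>9 D\<close> is within the target because
  \<open>sqrt (d ln n / n)\<close> exceeds \<open>1/2\<close>.\<close>

lemma uniform_deviation_small_sample:
  assumes n: "2 \<le> n" "n < d" and "1 \<le> M"
  defines "Q \<equiv> PiM {..<n} (\<lambda>_. P)"
  shows "\<exists>E\<in>sets Q. 1 - exp (- real d * ln (real n)) \<le> measure Q E \<and>
    (\<forall>X\<in>E. \<forall>mu i. i < M \<longrightarrow> (\<forall>j<M. vnorm d (mu j) \<le> 2 * R) \<longrightarrow>
      vnorm d (\<lambda>k. G_pop M d w mustar mu i k - G_emp M d w n X mu i k) \<le> 52 * uniform_bound n)"
proof -
  interpret Q: prob_space Q
    unfolding Q_def by (rule prob_space_PiM) (rule prob_space_axioms)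
  define l where "l = ln (real n)"
  have l: "1 / 2 \<le> l" "real n = exp l"
    using half_le_ln[OF n(1)] n by (auto simp: l_def)
  define e where "e = sqrt (real d * l / real n)"
  \<comment> \<open>\<open>1152 = 3 * 384\<close> makes the tail exponent \<open>3 d l\<close>: one
    \<open>d l\<close> pays for the subsets, one for \<open>sqrt 2 ^ d\<close>, and one is
    left.\<close>
  define t where "t = sqrt (1152 * D\<^sup>2 * (real n * real d * l))"
  have t: "0 \<le> t" "t\<^sup>2 = 1152 * D\<^sup>2 * (real n * real d * l)"
    using l by (auto simp: t_def)
  let ?A = "\<lambda>S. {X \<in> space Q. t \<le> vnorm d (\<lambda>k. \<Sum>j\<in>S. X j k - mean k)}"
  let ?U = "\<Union>S\<in>Pow {..<n}. ?A S"
  have A: "?A S \<in> Q.events" "Q.prob (?A S) \<le> sqrt 2 ^ d * exp (- t\<^sup>2 / (384 * D\<^sup>2 * real n))"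
    if "S \<in> Pow {..<n}" for S
    using sample_tail[of n S t] that n t by (auto simp: Q_def)
  have U: "?U \<in> Q.events" using A(1) by (intro sets.finite_UN) auto
  have "Q.prob ?U \<le> real (card (Pow {..<n})) * (sqrt 2 ^ d * exp (- t\<^sup>2 / (384 * D\<^sup>2 * real n)))"
    by (rule Q.prob_UN_le_card) (use A in auto)
  also have "\<dots> = 2 ^ n * (sqrt 2 ^ d * exp (- (3 * (real d * l))))"
    using n D_ge_1 by (simp add: card_Pow t)
  also have "\<dots> \<le> exp (real d * l) * (exp (real d * l) * exp (- (3 * (real d * l))))"
  proof (intro mult_mono)
    have "(2::real) ^ n \<le> 2 ^ d" using n by (intro power_increasing) auto
    also have "\<dots> \<le> real n ^ d" using n by (intro power_mono) auto
    also have "\<dots> = exp (real d * l)" by (simp add: l exp_of_nat_mult)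
    finally show "(2::real) ^ n \<le> exp (real d * l)" .
    have "sqrt 2 \<le> (2 :: real)" by (rule real_le_lsqrt) auto
    then have "sqrt 2 ^ d \<le> real n ^ d" using n by (intro power_mono) auto
    also have "\<dots> = exp (real d * l)" by (simp add: l exp_of_nat_mult)
    finally show "sqrt 2 ^ d \<le> exp (real d * l)" .
  qed auto
  also have "\<dots> = exp (- real d * l)"
    by (simp flip: exp_add)
  finally have PU: "Q.prob ?U \<le> exp (- real d * l)" .
  have "1 - exp (- real d * l) \<le> Q.prob (space Q - ?U)"
    using PU U by (simp add: Q.prob_compl)
  moreover have "vnorm d (\<lambda>k. G_pop M d w mustar mu i k - G_emp M d w n X mu i k) \<le> 52 * uniform_bound n"
    if X: "X \<in> space Q - ?U" and i: "i < M" and mu: "\<forall>j<M. vnorm d (mu j) \<le> 2 * R" for X mu i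
  proof -
    have "vnorm d (\<lambda>k. G_pop M d w mustar mu i k - G_emp M d w n X mu i k) \<le> 9 * D + t / real n"
      using X i mu n t by (intro G_dev_le_of_subset_sums) (auto simp: not_le intro: less_imp_le)
    also have "t / real n = sqrt 1152 * D * e"
    proof -
      have "t = sqrt (1152 * D\<^sup>2 * (real d * l / real n) * (real n)\<^sup>2)"
        using n by (simp add: t_def power2_eq_square field_simps)
      also have "\<dots> = sqrt 1152 * D * e * real n"
        unfolding e_def using D_ge_1 by (simp only: real_sqrt_mult real_sqrt_abs abs_of_nat abs_of_nonneg)
      finally show ?thesis using n by simp
    qed
    also have "\<dots> \<le> 34 * (D * e)"
    proof -
      have "sqrt 1152 \<le> (34 :: real)" by (rule real_le_lsqrt) auto
      then have "sqrt 1152 * (D * e) \<le> 34 * (D * e)"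
        using D_ge_1 l by (intro mult_right_mono) (auto simp: e_def)
      then show ?thesis by (simp add: mult.assoc)
    qed
    also have "9 * D + 34 * (D * e) \<le> 52 * (D * e)"
    proof -
      have "(1 / 2)\<^sup>2 \<le> 1 * l" using l by (simp add: power2_eq_square)
      also have "\<dots> \<le> (real d / real n) * l"
        using n l by (intro mult_right_mono) (auto simp: field_simps)
      finally have "1 / 2 \<le> e"
        unfolding e_def by (intro real_le_rsqrt) simp
      then have "D * (1 / 2) \<le> D * e" using D_ge_1 by (intro mult_left_mono) auto
      then show ?thesis by linarith
    qed
    also have "\<dots> \<le> 52 * uniform_bound n"
    proof -
      have "D * 1 * e \<le> D ^ 3 * sqrt (real M) * e"
        using D_ge_1 \<open>1 \<le> M\<close> l power_increasing[of 1 3 D]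
        by (intro mult_mono) (auto simp: e_def)
      then show ?thesis by (simp add: uniform_bound_def e_def l_def)
    qed
    finally show ?thesis by simp
  qed
  ultimately show ?thesis
    using U unfolding l_def by (intro bexI[of _ "space Q - ?U"]) auto
qed

text \<open>Two kinds of bad events: some sample is too long, or the deviation is too large at some
  grid point. Outside both, a center is compared with its rounding, for \<open>G_pop\<close> and
  \<open>G_emp\<close> separately.\<close>

lemma uniform_deviation_large_sample:
  assumes n: "2 \<le> n" "d \<le> n" and d1: "1 \<le> d" and M1: "1 \<le> M"
  defines "Q \<equiv> PiM {..<n} (\<lambda>_. P)"
  shows "\<exists>E\<in>sets Q. 1 - exp (- real d * ln (real n)) \<le> measure Q E \<and>
    (\<forall>X\<in>E. \<forall>mu i. i < M \<longrightarrow> (\<forall>j<M. vnorm d (mu j) \<le> 2 * R) \<longrightarrow>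
      vnorm d (\<lambda>k. G_pop M d w mustar mu i k - G_emp M d w n X mu i k) \<le> 4175 * uniform_bound n)"
proof -
  interpret Q: prob_space Q
    unfolding Q_def by (rule prob_space_PiM) (rule prob_space_axioms)
  define l where "l = ln (real n)"
  have l: "1 / 2 \<le> l" "real n = exp l" "l \<le> real n"
    using half_le_ln[OF n(1)] n ln_bound[of "real n"] by (auto simp: l_def)
  define e where "e = sqrt (real d * l / real n)"
  have e0: "0 \<le> e" using l by (simp add: e_def)
  have n1: "1 \<le> n" using n by simp
  \<comment> \<open>The mesh must beat the squared sample length, of order \<open>D^2 n d l\<close>.
    Cubic resolution achieves \<open>\<delta> n d l <= e\<close> because \<open>d\<close> and
    \<open>l\<close> are at most \<open>n\<close>, and its logarithm is still only
    \<open>3 l\<close>.\<close>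
  define s where "s = real n ^ 3"
  define \<delta> where "\<delta> = sqrt (real d) / s"
  define N where "N = \<lceil>2 * R * s\<rceil> + 1"
  have s1: "1 \<le> s" using n by (simp add: s_def)
  have ndl: "1 \<le> real n * l" "1 \<le> real n * real d * l"
  proof -
    have "2 * (1 / 2) \<le> real n * l" using n l by (intro mult_mono) auto
    then show 1: "1 \<le> real n * l" by simp
    have "1 * 1 \<le> real d * (real n * l)" using 1 d1 by (intro mult_mono) auto
    then show "1 \<le> real n * real d * l" by (simp add: mult_ac)
  qed
  have \<delta>: "0 \<le> \<delta>" "\<delta> \<le> 1" "\<delta> * (real n * real d * l) \<le> e"
  proof -
    show "0 \<le> \<delta>" using s1 by (simp add: \<delta>_def)
    have "sqrt (real d) \<le> real d" using d1 by (intro real_le_lsqrt) (auto simp: power2_eq_square)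
    also have "\<dots> \<le> real n ^ 1" using n by simp
    also have "\<dots> \<le> s" unfolding s_def using n by (intro power_increasing) auto
    finally show "\<delta> \<le> 1" using s1 by (simp add: \<delta>_def)
    have "\<delta> * (real n * real d * l) = (real d * l) * (sqrt (real d) / (real n)\<^sup>2)"
      using n by (simp add: \<delta>_def s_def power2_eq_square power3_eq_cube)
    also have "\<dots> \<le> e"
      unfolding e_def
    proof (rule real_le_rsqrt)
      have "((real d * l) * (sqrt (real d) / (real n)\<^sup>2))\<^sup>2 = (real d * l / real n) * ((real d)\<^sup>2 * l / real n ^ 3)"
        using n by (simp add: power_mult_distrib power_divide) (simp add: power2_eq_square power3_eq_cube power4_eq_xxxx field_simps)
      also have "\<dots> \<le> (real d * l / real n) * 1"
      proof (rule mult_left_mono)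
        have "(real d)\<^sup>2 * l \<le> (real n)\<^sup>2 * real n"
          using n l by (intro mult_mono power_mono) auto
        then show "(real d)\<^sup>2 * l / real n ^ 3 \<le> 1"
          using n by (simp add: power2_eq_square power3_eq_cube)
      qed (use l in auto)
      finally show "((real d * l) * (sqrt (real d) / (real n)\<^sup>2))\<^sup>2 \<le> real d * l / real n" by simp
    qed
    finally show "\<delta> * (real n * real d * l) \<le> e" .
  qed
  have sqrt2: "sqrt 2 ^ d \<le> exp (real d * l)"
  proof -
    have "sqrt 2 \<le> (2 :: real)" by (rule real_le_lsqrt) auto
    then have "sqrt 2 ^ d \<le> real n ^ d" using n by (intro power_mono) auto
    also have "\<dots> = exp (real d * l)" by (simp add: l exp_of_nat_mult)
    finally show ?thesis .
  qed

  \<comment> \<open>\<open>1536 = 4 * 384\<close>: the exponent \<open>4 d l\<close> pays for the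
    \<open>n\<close> samples and for \<open>sqrt 2 ^ d\<close>, leaving \<open>2 d l\<close>. The
    singleton is bounded with the proxy of the full sum; the loss of \<open>sqrt n\<close> is
    harmless given the fine mesh.\<close>
  define t1 where "t1 = sqrt (1536 * D\<^sup>2 * (real n * real d * l))"
  have t1: "0 \<le> t1" "t1\<^sup>2 = 1536 * D\<^sup>2 * (real n * real d * l)"
    using l by (auto simp: t1_def)
  let ?A1 = "\<lambda>j. {X \<in> space Q. t1 \<le> vnorm d (\<lambda>k. \<Sum>j\<in>{j}. X j k - mean k)}"
  let ?U1 = "\<Union>j\<in>{..<n}. ?A1 j"
  have A1: "?A1 j \<in> Q.events" "Q.prob (?A1 j) \<le> sqrt 2 ^ d * exp (- t1\<^sup>2 / (384 * D\<^sup>2 * real n))"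
    if "j \<in> {..<n}" for j
    using sample_tail[of n "{j}" t1] that n t1 unfolding Q_def by auto
  have U1: "?U1 \<in> Q.events" using A1(1) by (intro sets.finite_UN) auto
  have "Q.prob ?U1 \<le> real (card {..<n}) * (sqrt 2 ^ d * exp (- t1\<^sup>2 / (384 * D\<^sup>2 * real n)))"
    by (rule Q.prob_UN_le_card) (use A1 in auto)
  also have "\<dots> = exp l * (sqrt 2 ^ d * exp (- (4 * (real d * l))))"
    using n D_ge_1 by (simp add: t1 l(2)[symmetric])
  also have "\<dots> \<le> exp (real d * l) * (exp (real d * l) * exp (- (4 * (real d * l))))"
    using d1 l sqrt2 by (intro mult_mono) auto
  also have "\<dots> = exp (- (2 * (real d * l)))"
    by (simp flip: exp_add)
  finally have PU1: "Q.prob ?U1 \<le> exp (- (2 * (real d * l)))" .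

  \<comment> \<open>\<open>4992 = 13 * 384\<close>, so the exponent is 13 units of
    \<open>D M d l\<close>: eight for the net, two for the index \<open>i\<close>, one for
    \<open>sqrt 2 ^ d\<close>, two left over. The third power of \<open>D\<close> is the squared
    proxy scale \<open>D^2\<close> times the \<open>D\<close> in the net's cardinality.\<close>
  define t2 where "t2 = sqrt (4992 * D ^ 3 * real M) * e"
  have t2: "0 \<le> t2" "real n * t2\<^sup>2 / (384 * D\<^sup>2) = 13 * (D * real M * real d * l)"
  proof -
    show "0 \<le> t2" using e0 D_ge_1 by (simp add: t2_def)
    have "e\<^sup>2 = real d * l / real n" using l by (simp add: e_def)
    then have "t2\<^sup>2 = 4992 * D ^ 3 * real M * (real d * l / real n)"
      using D_ge_1 by (simp add: t2_def power_mult_distrib)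
    moreover have "real n * (4992 * x ^ 3 * real M * (real d * l / real n)) / (384 * x\<^sup>2)
        = 13 * (x * real M * real d * l)" if "0 < x" for x
      using that n by (simp add: power2_eq_square power3_eq_cube)
    ultimately show "real n * t2\<^sup>2 / (384 * D\<^sup>2) = 13 * (D * real M * real d * l)"
      using D_ge_1 by simp
  qed
  \<comment> \<open>The grid is a cube whose corners may have norm of order \<open>sqrt d\<close>;
    discarding points beyond \<open>2 R + 1\<close> keeps the tail bound valid with the same
    \<open>D\<close>.\<close>
  define Net where "Net = {nu \<in> grid M d s N. \<forall>j<M. vnorm d (nu j) \<le> 2 * R + 1}"
  have fN: "finite Net" using finite_grid by (simp add: Net_def)
  let ?A2 = "\<lambda>(nu, i). {X \<in> space Q. t2 \<le> vnorm d (\<lambda>k. G_pop M d w mustar nu i k - G_emp M d w n X nu i k)}"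
  let ?U2 = "\<Union>z\<in>Net \<times> {..<M}. ?A2 z"
  have A2: "?A2 z \<in> Q.events" "Q.prob (?A2 z) \<le> sqrt 2 ^ d * exp (- (real n * t2\<^sup>2) / (384 * D\<^sup>2))"
    if zN: "z \<in> Net \<times> {..<M}" for z
  proof -
    obtain nu i where z: "z = (nu, i)" "nu \<in> Net" "i < M" using zN by auto
    then have "vnorm d (nu i) \<le> 2 * R + 1" by (simp add: Net_def)
    note tail = G_tail[of n t2 i nu, OF n1 t2(1) z(3) this, folded Q_def]
    show "?A2 z \<in> Q.events" "Q.prob (?A2 z) \<le> sqrt 2 ^ d * exp (- (real n * t2\<^sup>2) / (384 * D\<^sup>2))"
      unfolding z(1) case_prod_conv by (rule tail)+
  qed
  have U2: "?U2 \<in> Q.events" using A2(1) fN by (intro sets.finite_UN) blast+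
  have cardN: "real (card Net) \<le> exp (8 * (D * real M * real d * l))"
  proof -
    have N0: "0 \<le> N" using ceiling_mono[of 0 "2 * R * s"] R_nonneg s1 by (simp add: N_def)
    have "card Net \<le> card (grid M d s N)"
      unfolding Net_def by (intro card_mono finite_grid) auto
    then have "real (card Net) \<le> (2 * real_of_int N + 1) ^ (d * M)"
      using card_grid_le[OF N0, of M d s] by linarith
    also have "\<dots> \<le> exp (8 * D * l) ^ (d * M)"
    proof (rule power_mono)
      have "2 * real_of_int N + 1 \<le> 4 * (R * s) + 5"
        unfolding N_def of_int_add of_int_1
        using of_int_ceiling_le_add_one[of "2 * R * s"] by argo
      also have "\<dots> \<le> 5 * D * s"
      proof -
        have "0 \<le> R * s" using s1 R_nonneg by simp
        moreover have "5 * D * s = 5 * s + 15 * (R * s)" by (simp add: algebra_simps)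
        ultimately show ?thesis using s1 by linarith
      qed
      \<comment> \<open>Here \<open>5 <= 2^3 <= n^3\<close>, and \<open>D <= 2 D l\<close> because
        \<open>l >= 1/2\<close>: the bare radius is traded for a multiple of
        \<open>l\<close>.\<close>
      also have "\<dots> \<le> exp (3 * l) * exp (2 * D * l) * exp (3 * l)"
      proof (intro mult_mono)
        have "s = exp (3 * l)"
          unfolding s_def using exp_of_nat_mult[of 3 l] by (simp add: l(2))
        moreover have "2 ^ 3 \<le> s" unfolding s_def using n by (intro power_mono) auto
        ultimately show "5 \<le> exp (3 * l)" "s \<le> exp (3 * l)" by auto
        have "D * 1 \<le> D * (2 * l)" using l D_ge_1 by (intro mult_left_mono) auto
        moreover have "D * (2 * l) = 2 * D * l" by simp
        moreover have "x \<le> exp x" for x :: real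
          using exp_ge_add_one_self[of x] by linarith
        ultimately show "D \<le> exp (2 * D * l)"
          by (metis mult.right_neutral order_trans)
      qed (use D_ge_1 s1 in auto)
      also have "\<dots> = exp ((6 + 2 * D) * l)"
        by (simp add: algebra_simps flip: exp_add)
      also have "\<dots> \<le> exp (8 * D * l)"
        using D_ge_1 l by (intro exp_le_cancel_iff[THEN iffD2] mult_right_mono) auto
      finally show "2 * real_of_int N + 1 \<le> exp (8 * D * l)" .
    qed (use N0 in auto)
    also have "\<dots> = exp (8 * (D * real M * real d * l))"
      by (simp add: mult_ac flip: exp_of_nat_mult)
    finally show ?thesis .
  qed
  have dl: "real d * l \<le> D * real M * real d * l"
  proof -
    have "1 * (real d * l) \<le> (D * real M) * (real d * l)"
      using D_ge_1 M1 l mult_mono[of 1 D 1 "real M"] by (intro mult_right_mono) auto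
    then show ?thesis by (simp add: mult_ac)
  qed
  have MM: "real M \<le> exp (2 * (D * real M * real d * l))"
  proof -
    have "1 * 1 * real M * 1 \<le> D * real d * real M * (2 * l)"
      using D_ge_1 d1 l by (intro mult_mono) auto
    then have "real M \<le> 2 * (D * real M * real d * l)" by (simp add: mult_ac)
    then show ?thesis using exp_ge_add_one_self[of "2 * (D * real M * real d * l)"] by linarith
  qed
  have "Q.prob ?U2 \<le> real (card (Net \<times> {..<M})) * (sqrt 2 ^ d * exp (- (real n * t2\<^sup>2) / (384 * D\<^sup>2)))"
    using A2 fN by (intro Q.prob_UN_le_card) blast+
  also have "\<dots> = real (card Net) * real M * (sqrt 2 ^ d * exp (- (13 * (D * real M * real d * l))))"
    using t2(2) by (simp add: card_cartesian_product)
  also have "\<dots> \<le> exp (8 * (D * real M * real d * l)) * exp (2 * (D * real M * real d * l))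
      * (exp (D * real M * real d * l) * exp (- (13 * (D * real M * real d * l))))"
    using cardN MM sqrt2 dl
    by (intro mult_mono order_trans[OF sqrt2]) auto
  also have "\<dots> = exp (- (2 * (D * real M * real d * l)))"
    by (simp flip: exp_add)
  also have "\<dots> \<le> exp (- (2 * (real d * l)))"
    using dl by simp
  finally have PU2: "Q.prob ?U2 \<le> exp (- (2 * (real d * l)))" .

  let ?E = "space Q - (?U1 \<union> ?U2)"
  have EQ: "?E \<in> Q.events" using U1 U2 by auto
  \<comment> \<open>The spare unit in both exponents absorbs the factor 2 of the union, as
    \<open>2 <= n <= exp (d l)\<close>.\<close>
  have "Q.prob (?U1 \<union> ?U2) \<le> exp (- real d * l)"
  proof -
    have "2 * exp (- real d * l) \<le> 1"
    proof -
      have "2 \<le> exp l" using n by (simp add: l(2)[symmetric])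
      also have "\<dots> \<le> exp (real d * l)" using d1 l by simp
      finally show ?thesis by (simp add: exp_minus field_simps)
    qed
    then have "(2 * exp (- real d * l)) * exp (- real d * l) \<le> 1 * exp (- real d * l)"
      by (intro mult_right_mono) auto
    moreover have "exp (- (2 * (real d * l))) = exp (- real d * l) * exp (- real d * l)"
      by (simp flip: exp_add)
    ultimately have "2 * exp (- (2 * (real d * l))) \<le> exp (- real d * l)"
      by linarith
    moreover have "Q.prob (?U1 \<union> ?U2) \<le> Q.prob ?U1 + Q.prob ?U2"
      using U1 U2 by (rule measure_Un_le)
    ultimately show ?thesis using PU1 PU2 by linarith
  qed
  then have "1 - exp (- real d * l) \<le> Q.prob ?E"
    using sets.Un[OF U1 U2] by (simp add: Q.prob_compl)
  moreover have "vnorm d (\<lambda>k. G_pop M d w mustar mu i k - G_emp M d w n X mu i k) \<le> 4175 * uniform_bound n"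
    if X: "X \<in> ?E" and i: "i < M" and mu: "\<forall>j<M. vnorm d (mu j) \<le> 2 * R" for X mu i
  proof -
    have mu1: "vnorm d (mu j) \<le> 2 * R + 1" if "j < M" for j
      using mu that by fastforce
    have "2 * R * s + 1 \<le> real_of_int N" unfolding N_def by linarith
    then obtain nu where nu: "nu \<in> grid M d s N"
      and close: "\<And>j. j < M \<Longrightarrow> vnorm d (\<lambda>k. mu j k - nu j k) \<le> \<delta>"
      using grid_approximation[of M d mu "2 * R" s N] mu s1 unfolding \<delta>_def by auto
    have nu1: "vnorm d (nu j) \<le> 2 * R + 1" if "j < M" for j
    proof -
      have "vnorm d (nu j) = vnorm d (\<lambda>k. mu j k - (mu j k - nu j k))" by simp
      also have "\<dots> \<le> vnorm d (mu j) + vnorm d (\<lambda>k. mu j k - nu j k)" by (rule vnorm_diff_le)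
      finally show ?thesis using mu close[OF that] \<delta>(2) that by fastforce
    qed
    have "nu \<in> Net" using nu nu1 by (simp add: Net_def)
    then have I2: "vnorm d (\<lambda>k. G_pop M d w mustar nu i k - G_emp M d w n X nu i k) \<le> t2"
      using X i by fastforce
    \<comment> \<open>\<open>45 = 40 + 4 + 1\<close>: the deviation \<open>t1\<close>, the norm of
      the mean, and \<open>2 R + 1 <= D\<close>, each measured in
      \<open>D sqrt (n d l)\<close>.\<close>
    define T where "T = 45 * D * sqrt (real n * real d * l)"
    have T: "vnorm d (X j) + (2 * R + 1) \<le> T" if "j < n" for j
    proof -
      have "vnorm d (\<lambda>k. X j k - mean k) \<le> t1"
        using X that by fastforce
      moreover have "vnorm d (X j) \<le> vnorm d (\<lambda>k. X j k - mean k) + vnorm d mean"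
        using vnorm_triangle[of d "\<lambda>k. X j k - mean k" mean] by simp
      moreover have "vnorm d mean \<le> 4 * D"
      proof -
        have "sqrt 12 \<le> (4 :: real)" by (rule real_le_lsqrt) auto
        then have "sqrt 12 * D \<le> 4 * D" using D_ge_1 by (intro mult_right_mono) auto
        then show ?thesis using mean_norm_le by linarith
      qed
      moreover have "t1 \<le> 40 * (D * sqrt (real n * real d * l))"
      proof -
        have "sqrt 1536 \<le> (40 :: real)" by (rule real_le_lsqrt) auto
        then have "sqrt 1536 * (D * sqrt (real n * real d * l)) \<le> 40 * (D * sqrt (real n * real d * l))"
          using D_ge_1 l by (intro mult_right_mono) auto
        moreover have "t1 = sqrt 1536 * (D * sqrt (real n * real d * l))"
          unfolding t1_def using D_ge_1 by (simp add: real_sqrt_mult)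
        ultimately show ?thesis by simp
      qed
      moreover have "D * 1 \<le> D * sqrt (real n * real d * l)"
        using D_ge_1 ndl by (intro mult_left_mono) auto
      moreover have "T = 45 * (D * sqrt (real n * real d * l))" unfolding T_def by (rule mult.assoc)
      moreover have "2 * R + 1 \<le> D" using R_nonneg by simp
      ultimately show ?thesis by argo
    qed
    have T2: "T\<^sup>2 = 2025 * D\<^sup>2 * (real n * real d * l)"
      unfolding T_def power_mult_distrib using l by simp
    have D2: "1 \<le> D\<^sup>2" using D_ge_1 by (simp add: one_le_power)
    have "vnorm d (\<lambda>k. G_emp M d w n X mu i k - G_emp M d w n X nu i k) \<le> \<delta> * (2 * T\<^sup>2 + 1)"
      using n by (intro G_emp_diff_le i \<delta> mu1 nu1 close T) auto
    also have "\<dots> \<le> \<delta> * (4051 * D\<^sup>2 * (real n * real d * l))"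
    proof (rule mult_left_mono)
      have "1 * 1 \<le> D\<^sup>2 * (real n * real d * l)"
        using D2 ndl by (intro mult_mono) auto
      then show "2 * T\<^sup>2 + 1 \<le> 4051 * D\<^sup>2 * (real n * real d * l)"
        unfolding T2 by linarith
    qed (rule \<delta>)
    also have "\<dots> = 4051 * D\<^sup>2 * (\<delta> * (real n * real d * l))"
      by simp
    also have "\<dots> \<le> 4051 * D\<^sup>2 * e"
      using \<delta> D2 by (intro mult_left_mono) auto
    finally have I1: "vnorm d (\<lambda>k. G_emp M d w n X mu i k - G_emp M d w n X nu i k) \<le> 4051 * D\<^sup>2 * e" .
    have "vnorm d (\<lambda>k. G_pop M d w mustar mu i k - G_pop M d w mustar nu i k) \<le> 53 * \<delta> * D\<^sup>2 * real d"
      by (intro G_pop_diff_le i \<delta> d1 mu1 nu1 close) auto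
    also have "\<dots> = 53 * D\<^sup>2 * (\<delta> * (real d * 1))" by simp
    also have "\<dots> \<le> 53 * D\<^sup>2 * (\<delta> * (real d * (real n * l)))"
      using ndl \<delta> D2 by (intro mult_left_mono) auto
    also have "\<dots> \<le> 53 * D\<^sup>2 * e"
      using \<delta> D2 by (intro mult_left_mono) (auto simp: mult_ac)
    finally have I3: "vnorm d (\<lambda>k. G_pop M d w mustar mu i k - G_pop M d w mustar nu i k) \<le> 53 * D\<^sup>2 * e" .
    have D3: "D\<^sup>2 \<le> D ^ 3" "D ^ 3 \<le> (D ^ 3)\<^sup>2"
      using D_ge_1 by (auto intro: power_increasing simp: self_le_power simp flip: power_mult)
    have "t2 \<le> 71 * (D ^ 3 * sqrt (real M)) * e"
      unfolding t2_def
    proof (rule mult_right_mono[OF _ e0], rule real_le_lsqrt)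
      have "4992 * D ^ 3 * real M \<le> 5041 * (D ^ 3)\<^sup>2 * real M"
        using D3 D_ge_1 by (intro mult_right_mono mult_mono) auto
      then show "4992 * D ^ 3 * real M \<le> (71 * (D ^ 3 * sqrt (real M)))\<^sup>2"
        by (simp add: power_mult_distrib)
    qed (use D_ge_1 in auto)
    then have t2': "t2 \<le> 71 * uniform_bound n"
      by (simp add: uniform_bound_def e_def l_def)
    have De: "D\<^sup>2 * e \<le> uniform_bound n"
    proof -
      have "D\<^sup>2 * 1 * e \<le> D ^ 3 * sqrt (real M) * e"
        using D3 M1 e0 D_ge_1 by (intro mult_mono) auto
      then show ?thesis by (simp add: uniform_bound_def e_def l_def)
    qed
    \<comment> \<open>\<open>4175 = 53 + 71 + 4051\<close>: population rounding, deviation at the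
      grid point with \<open>sqrt 4992 <= 71\<close>, and empirical rounding with
      \<open>4051 = 2 * 45^2 + 1\<close>.\<close>
    have "vnorm d (\<lambda>k. G_pop M d w mustar mu i k - G_emp M d w n X mu i k)
      \<le> vnorm d (\<lambda>k. G_pop M d w mustar mu i k - G_pop M d w mustar nu i k)
       + (vnorm d (\<lambda>k. G_pop M d w mustar nu i k - G_emp M d w n X nu i k)
       + vnorm d (\<lambda>k. G_emp M d w n X nu i k - G_emp M d w n X mu i k))"
      by (rule order_trans[OF vnorm_diff_triangle add_left_mono[OF vnorm_diff_triangle]])
    also have "\<dots> \<le> 53 * D\<^sup>2 * e + (t2 + 4051 * D\<^sup>2 * e)"
      by (intro add_mono I2 I3) (subst vnorm_diff_commute, rule I1)
    also have "\<dots> \<le> 4175 * uniform_bound n"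
      using t2' De by linarith
    finally show ?thesis .
  qed
  ultimately show ?thesis
    using EQ unfolding l_def by (intro bexI[of _ ?E]) auto
qed

end

section \<open>From pairwise distances to the abstract radius, and the final statement\<close>

lemma finite_pairwise_distances:
  "finite {vnorm d (\<lambda>k. mu i k - mu j k) | i j. i < M \<and> j < M \<and> i \<noteq> j}" for M :: nat
  by (rule finite_subset[of _ "(\<lambda>(i, j). vnorm d (\<lambda>k. mu i k - mu j k)) ` ({..<M} \<times> {..<M})"]) auto

lemma dist_le_Rmax: "i < M \<Longrightarrow> j < M \<Longrightarrow> i \<noteq> j \<Longrightarrow> vnorm d (\<lambda>k. mu i k - mu j k) \<le> Rmax M d mu"
  unfolding Rmax_def by (rule Max_ge[OF finite_pairwise_distances]) auto

lemma Rmin_le_dist: "i < M \<Longrightarrow> j < M \<Longrightarrow> i \<noteq> j \<Longrightarrow> Rmin M d mu \<le> vnorm d (\<lambda>k. mu i k - mu j k)"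
  unfolding Rmin_def by (rule Min_le[OF finite_pairwise_distances]) auto

text \<open>Because the weighted mean of the centers is zero, \<open>mu i\<close> is the average of
  the differences \<open>mu i - mu j\<close>.\<close>

lemma center_norm_le_Rmax:
  assumes "\<forall>i<M. 0 < w i" "(\<Sum>i<M. w i) = 1" "\<forall>k<d. (\<Sum>i<M. w i * mu i k) = 0" "i < M" "0 \<le> Rmax M d mu"
  shows "vnorm d (mu i) \<le> Rmax M d mu"
proof -
  have "vnorm d (mu i) = vnorm d (\<lambda>k. \<Sum>j<M. w j * (mu i k - mu j k))"
    using assms(2,3)
    by (intro vnorm_cong) (simp add: right_diff_distrib sum_subtractf flip: sum_distrib_right)
  also have "\<dots> \<le> (\<Sum>j<M. vnorm d (\<lambda>k. w j * (mu i k - mu j k)))"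
    by (rule vnorm_sum_le) simp
  also have "\<dots> \<le> (\<Sum>j<M. w j * Rmax M d mu)"
  proof (rule sum_mono)
    fix j assume j: "j \<in> {..<M}"
    have "vnorm d (\<lambda>k. mu i k - mu j k) \<le> Rmax M d mu"
      using dist_le_Rmax[of i M j d mu] assms(4,5) j by (cases "i = j") (auto simp: vnorm_0)
    then show "vnorm d (\<lambda>k. w j * (mu i k - mu j k)) \<le> w j * Rmax M d mu"
      unfolding vnorm_scale using assms(1) j by (simp add: mult_left_mono abs_of_pos)
  qed
  also have "\<dots> = Rmax M d mu"
    using assms(2) by (simp flip: sum_distrib_right)
  finally show ?thesis .
qed

lemma uniform_deviation:
  fixes a :: real
  assumes M: "2 \<le> M" and d: "1 \<le> d" and n: "1 \<le> n"
    and w: "\<forall>i<M. 0 < w i" "(\<Sum>i<M. w i) = 1"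
    and rv: "\<forall>i<M. mustar i \<in> rvec d" and cen: "\<forall>k<d. (\<Sum>i<M. w i * mustar i k) = 0"
    and a: "0 \<le> a" "a \<le> Rmin M d mustar / 2"
  defines "Q \<equiv> PiM {..<n} (\<lambda>_. gmm M d w mustar)"
  shows "\<exists>E\<in>sets Q. E \<subseteq> {X \<in> space Q. \<forall>i<M. (SUP mu \<in> ballprod M d mustar a.
            vnorm d (\<lambda>k. G_pop M d w mustar mu i k - G_emp M d w n X mu i k)) < eps_unif 5000 M d w mustar n}
      \<and> 1 - exp (- real d * ln (real n)) \<le> measure Q E"
proof (cases "n = 1")
  \<comment> \<open>For \<open>n = 1\<close> the logarithm is 0, so \<open>eps_unif\<close> is 0 and
    no strict inequality can hold; the required probability is 0 as well, and the empty set
    serves.\<close>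
  case True
  then show ?thesis by (intro bexI[of _ "{}"]) auto
next
  case False
  then have n2: "2 \<le> n" using n by simp
  let ?R = "Rmax M d mustar"
  have dist: "Rmin M d mustar \<le> vnorm d (\<lambda>k. mustar 0 k - mustar 1 k)"
    "vnorm d (\<lambda>k. mustar 0 k - mustar 1 k) \<le> ?R"
    using M by (auto intro!: Rmin_le_dist dist_le_Rmax)
  then have R: "0 \<le> ?R" "Rmin M d mustar \<le> ?R"
    using vnorm_nonneg[of d "\<lambda>k. mustar 0 k - mustar 1 k"] by linarith+
  interpret gmm_bounded M d w mustar ?R
    by unfold_locales (use w cen R center_norm_le_Rmax in auto)
  define e where "e = uniform_bound n"
  have e: "0 < e"
    unfolding e_def uniform_bound_def using M d n2 R by (intro mult_pos_pos) auto
  have "\<exists>E\<in>sets Q. 1 - exp (- real d * ln (real n)) \<le> measure Q E \<and>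
    (\<forall>X\<in>E. \<forall>mu i. i < M \<longrightarrow> (\<forall>j<M. vnorm d (mu j) \<le> 2 * ?R) \<longrightarrow>
      vnorm d (\<lambda>k. G_pop M d w mustar mu i k - G_emp M d w n X mu i k) \<le> 4175 * e)"
  proof (cases "n < d")
    case True
    have "52 * e \<le> 4175 * e" using e by simp
    then show ?thesis
      using uniform_deviation_small_sample[OF n2 True] M unfolding Q_def e_def[symmetric]
      by (meson order_trans one_le_numeral)
  next
    case False
    then show ?thesis
      using uniform_deviation_large_sample[OF n2 _ d] M unfolding Q_def e_def by simp
  qed
  then obtain E where E: "E \<in> sets Q" "1 - exp (- real d * ln (real n)) \<le> measure Q E"
    and dev: "\<And>X mu i. X \<in> E \<Longrightarrow> i < M \<Longrightarrow> (\<forall>j<M. vnorm d (mu j) \<le> 2 * ?R) \<Longrightarrow>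
      vnorm d (\<lambda>k. G_pop M d w mustar mu i k - G_emp M d w n X mu i k) \<le> 4175 * e"
    by blast
  have ball: "\<forall>j<M. vnorm d (mu j) \<le> 2 * ?R" if mu: "mu \<in> ballprod M d mustar a" for mu
  proof (intro allI impI)
    fix j assume j: "j < M"
    then have "vnorm d (\<lambda>k. mu j k - mustar j k) \<le> a"
      using mu by (auto simp: ballprod_def PiE_iff)
    moreover have "vnorm d (mu j) \<le> vnorm d (\<lambda>k. mu j k - mustar j k) + vnorm d (mustar j)"
      using vnorm_triangle[of d "\<lambda>k. mu j k - mustar j k" "mustar j"] by simp
    ultimately show "vnorm d (mu j) \<le> 2 * ?R"
      using mustar_le[OF j] a R by linarith
  qed
  \<comment> \<open>\<open>cSUP_least\<close> needs a nonempty index set. The true centers must be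
    restricted to \<open>{..<M}\<close> because \<open>ballprod\<close> contains only extensional
    functions.\<close>
  have ne: "ballprod M d mustar a \<noteq> {}"
  proof -
    have "restrict mustar {..<M} \<in> ballprod M d mustar a"
      using rv a by (auto simp: ballprod_def vnorm_0)
    then show ?thesis by blast
  qed
  \<comment> \<open>The supremum inherits only a non-strict bound; the gap between 4175 and 5000
    with \<open>0 < e\<close> makes it strict.\<close>
  have eps: "4175 * e < eps_unif 5000 M d w mustar n"
  proof -
    have "sqrt (real M) \<le> real M powr (3 / 2)"
      using M by (simp add: powr_half_sqrt[symmetric] powr_mono)
    then have "(D ^ 3 * sqrt (real d * ln (real n) / real n)) * (sqrt (real M) * 1)
      \<le> (D ^ 3 * sqrt (real d * ln (real n) / real n)) * (real M powr (3 / 2) * max 1 (ln (kappa M w)))"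
      using R n2 by (intro mult_left_mono mult_mono) auto
    then have "5000 * e \<le> eps_unif 5000 M d w mustar n"
      by (simp add: e_def uniform_bound_def eps_unif_def mult_ac)
    then show ?thesis using e by linarith
  qed
  show ?thesis
  proof (intro bexI[OF _ E(1)] conjI E(2) subsetI CollectI allI impI)
    fix X assume X: "X \<in> E"
    then show "X \<in> space Q" using E(1) sets.sets_into_space by blast
    fix i assume i: "i < M"
    have "(SUP mu \<in> ballprod M d mustar a.
        vnorm d (\<lambda>k. G_pop M d w mustar mu i k - G_emp M d w n X mu i k)) \<le> 4175 * e"
      by (intro cSUP_least ne dev X i ball)
    then show "(SUP mu \<in> ballprod M d mustar a.
        vnorm d (\<lambda>k. G_pop M d w mustar mu i k - G_emp M d w n X mu i k)) < eps_unif 5000 M d w mustar n"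
      using eps by linarith
  qed
qed

theorem theorem8:
  shows "\<exists>C0>0. \<exists>C1>0. \<exists>c>0. \<exists>c'>0.
    \<forall>(M::nat) (d::nat) (w::nat \<Rightarrow> real) (mustar::nat \<Rightarrow> nat \<Rightarrow> real) (a::real) (n::nat).
      M \<ge> 2 \<longrightarrow> d \<ge> 1 \<longrightarrow> n \<ge> 1 \<longrightarrow>
      (\<forall>i<M. w i > 0) \<longrightarrow> (\<Sum>i<M. w i) = 1 \<longrightarrow>
      (\<forall>i<M. mustar i \<in> rvec d) \<longrightarrow>
      (\<forall>k<d. (\<Sum>i<M. w i * mustar i k) = 0) \<longrightarrow>
      (let d0 = real (min d M);
           L = ln (max (real M ^ 2 * kappa M w / pimin M w) (max (Rmax M d mustar) d0))
       in Rmin M d mustar \<ge> C0 * sqrt (d0 * L) \<and>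
          0 \<le> a \<and> a \<le> Rmin M d mustar / 2 - C1 * sqrt (d0 * L)) \<longrightarrow>
      (\<exists>E \<in> sets (PiM {..<n} (\<lambda>_. gmm M d w mustar)).
         E \<subseteq> {X \<in> space (PiM {..<n} (\<lambda>_. gmm M d w mustar)).
                 \<forall>i<M. (SUP mu \<in> ballprod M d mustar a.
                          vnorm d (\<lambda>k. G_pop M d w mustar mu i k - G_emp M d w n X mu i k))
                        < eps_unif c M d w mustar n} \<and>
         measure (PiM {..<n} (\<lambda>_. gmm M d w mustar)) E \<ge> 1 - exp (- c' * real d * ln (real n)))"
proof (rule exI[of _ 1], rule conjI, simp, rule exI[of _ 1], rule conjI, simp,
    rule exI[of _ 5000], rule conjI, simp, rule exI[of _ 1], rule conjI, simp, intro allI impI)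
  fix M d :: nat and w :: "nat \<Rightarrow> real" and mustar :: "nat \<Rightarrow> nat \<Rightarrow> real" and a :: real and n :: nat
  assume M: "2 \<le> M" and d: "1 \<le> d" and n: "1 \<le> n"
    and w: "\<forall>i<M. 0 < w i" "(\<Sum>i<M. w i) = 1"
    and mustar: "\<forall>i<M. mustar i \<in> rvec d" "\<forall>k<d. (\<Sum>i<M. w i * mustar i k) = 0"
    and sep: "let d0 = real (min d M);
           L = ln (max (real M ^ 2 * kappa M w / pimin M w) (max (Rmax M d mustar) d0))
       in 1 * sqrt (d0 * L) \<le> Rmin M d mustar \<and>
          0 \<le> a \<and> a \<le> Rmin M d mustar / 2 - 1 * sqrt (d0 * L)"
  \<comment> \<open>The maximum inside the logarithm is at least \<open>d0 >= 1\<close>, so the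
    subtracted term is nonnegative and \<open>a <= Rmin / 2\<close> follows.\<close>
  have "1 \<le> real (min d M)" using M d by simp
  then have "0 \<le> sqrt (real (min d M) *
      ln (max (real M ^ 2 * kappa M w / pimin M w) (max (Rmax M d mustar) (real (min d M)))))"
    by (intro real_sqrt_ge_zero mult_nonneg_nonneg ln_ge_zero) auto
  then have "0 \<le> a" "a \<le> Rmin M d mustar / 2"
    using sep unfolding Let_def by linarith+
  from uniform_deviation[OF M d n w mustar this]
  show "\<exists>E \<in> sets (PiM {..<n} (\<lambda>_. gmm M d w mustar)).
         E \<subseteq> {X \<in> space (PiM {..<n} (\<lambda>_. gmm M d w mustar)).
                 \<forall>i<M. (SUP mu \<in> ballprod M d mustar a.
                          vnorm d (\<lambda>k. G_pop M d w mustar mu i k - G_emp M d w n X mu i k))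
                        < eps_unif 5000 M d w mustar n} \<and>
         1 - exp (- 1 * real d * ln (real n)) \<le> measure (PiM {..<n} (\<lambda>_. gmm M d w mustar)) E"
    by simp
qed

end
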